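(* Let $(M,P,g)$ be an almost para-hermitian manifold, and let $G$ be the Sasakian metric on the tangent bundle $TM$ determined by $g$. Then the manifold $TM$ admits an almost para-hypercomplex structure $H=(J_1,J_2,J_3)$ which is para-hyperhermitian with respect to $G$, i.e. such that $G(J_\alpha X,J_\alpha Y)=\epsilon_\alpha G(X,Y)$ for all vector fields $X,Y$ on $TM$ and $\alpha=1,2,3$, where $\epsilon_1=1$, $\epsilon_2=\epsilon_3=-1$.
   Context: Manifolds and tensor fields are smooth. An almost product structure on a manifold $N$ is a $(1,1)$-tensor field $P\neq\pm \mathrm{Id}$ with $P^2=\mathrm{Id}$; an almost complex structure is a $(1,1)$-tensor field $J$ with $J^2=-\mathrm{Id}$. An almost para-hypercomplex structure on $N$ is a triple $H=(J_1,J_2,J_3)$ where $J_1$ is an almost complex structure, $J_2,J_3$ are almost product structures, and $J_2J_1=-J_1J_2=J_3$. An almost para-hermitian manifold $(M,P,g)$ is a manifold $M$ with an almost product structure $P$ and a semi-Riemannian metric $g$ such that $g(PX,PY)=-g(X,Y)$ for all vector fields $X,Y$ on $M$. Let $\pi:TM\to M$ be the natural projection and $K:T(TM)\to TM$ the connection map (Dombrowski) of the Levi-Civita connection of $g$. The Sasakian metric $G$ on $TM$ is defined by $G_t(X,Y)=g_{\pi(t)}(KX,KY)+g_{\pi(t)}(\pi_*X,\pi_*Y)$ for $t\in TM$ and $X,Y\in T_t(TM)$. *)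

theory Defs
  imports "HOL-Analysis.Analysis"
begin

section \<open>Smooth maps on open subsets of Euclidean spaces\<close>

fun C_k_on :: "nat \<Rightarrow> 'a::real_normed_vector set \<Rightarrow> ('a \<Rightarrow> 'b::real_normed_vector) \<Rightarrow> bool" where
  "C_k_on 0 S f \<longleftrightarrow> continuous_on S f"
| "C_k_on (Suc k) S f \<longleftrightarrow>
     (\<forall>x\<in>S. f differentiable (at x)) \<and>
     (\<forall>v. C_k_on k S (\<lambda>x. frechet_derivative f (at x) v))"

text \<open>Only used for open \<open>S\<close> in a finite-dimensional space, where it is the usual \<open>C\<^sup>\<infinity>\<close>.\<close>

definition smooth_on :: "'a::real_normed_vector set \<Rightarrow> ('a \<Rightarrow> 'b::real_normed_vector) \<Rightarrow> bool" where
  "smooth_on S f \<longleftrightarrow> (\<forall>k. C_k_on k S f)"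


section \<open>Smooth manifolds\<close>

text \<open>A manifold is given by an atlas; its underlying set is the union of the chart domains and
  its topology is the one making all chart domains open and all charts homeomorphisms onto open
  sets. The model space \<open>'e\<close> fixes the dimension \<open>DIM('e) \<ge> 1\<close>; on a zero-dimensional manifold
  there is no almost product structure, because there \<open>Id = - Id\<close>.\<close>

type_synonym ('m, 'e) chart = "'m set \<times> ('m \<Rightarrow> 'e)"

definition points :: "('m, 'e) chart set \<Rightarrow> 'm set" where
  "points A = \<Union> (fst ` A)"

definition smooth_atlas :: "('m, 'e::euclidean_space) chart set \<Rightarrow> bool" where
  "smooth_atlas A \<longleftrightarrow>
     (\<forall>(U, \<phi>)\<in>A. inj_on \<phi> U \<and> open (\<phi> ` U)) \<and>
     (\<forall>(U, \<phi>)\<in>A. \<forall>(V, \<psi>)\<in>A.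
        open (\<phi> ` (U \<inter> V)) \<and> smooth_on (\<phi> ` (U \<inter> V)) (\<psi> \<circ> inv_into U \<phi>))"

definition atlas_topology :: "('m, 'e::euclidean_space) chart set \<Rightarrow> 'm topology" where
  "atlas_topology A =
     topology (\<lambda>W. W \<subseteq> points A \<and> (\<forall>(U, \<phi>)\<in>A. open (\<phi> ` (W \<inter> U))))"

definition smooth_manifold :: "('m, 'e::euclidean_space) chart set \<Rightarrow> bool" where
  "smooth_manifold A \<longleftrightarrow>
     smooth_atlas A \<and> Hausdorff_space (atlas_topology A) \<and> second_countable (atlas_topology A)"

definition smooth_fun_on :: "('m, 'e::euclidean_space) chart set \<Rightarrow> 'm set \<Rightarrow> ('m \<Rightarrow> real) \<Rightarrow> bool" where
  "smooth_fun_on A W f \<longleftrightarrow>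
     openin (atlas_topology A) W \<and>
     (\<forall>(U, \<phi>)\<in>A. smooth_on (\<phi> ` (W \<inter> U)) (f \<circ> inv_into U \<phi>))"

abbreviation smooth_fun :: "('m, 'e::euclidean_space) chart set \<Rightarrow> ('m \<Rightarrow> real) \<Rightarrow> bool" where
  "smooth_fun A \<equiv> smooth_fun_on A (points A)"

definition smooth_near :: "('m, 'e::euclidean_space) chart set \<Rightarrow> 'm \<Rightarrow> ('m \<Rightarrow> real) \<Rightarrow> bool" where
  "smooth_near A p f \<longleftrightarrow> (\<exists>W. p \<in> W \<and> smooth_fun_on A W f)"


section \<open>Tangent vectors and the tangent bundle\<close>

text \<open>A tangent vector at \<open>p\<close> is a directional derivative \<open>\<Sum>\<^sub>i a\<^sup>i \<partial>/\<partial>x\<^sup>i\<close> at \<open>p\<close>, acting on the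
  functions that are smooth near \<open>p\<close>. By convention it is \<open>0\<close> on all other functions, so that
  tangent vectors are equal as soon as they agree on functions smooth near \<open>p\<close>.\<close>

type_synonym 'm tvec = "('m \<Rightarrow> real) \<Rightarrow> real"

definition tv_add :: "'m tvec \<Rightarrow> 'm tvec \<Rightarrow> 'm tvec" where
  "tv_add u v = (\<lambda>f. u f + v f)"

definition tv_scale :: "real \<Rightarrow> 'm tvec \<Rightarrow> 'm tvec" where
  "tv_scale a v = (\<lambda>f. a * v f)"

definition coord_vec ::
  "('m, 'e::euclidean_space) chart set \<Rightarrow> ('m, 'e) chart \<Rightarrow> 'm \<Rightarrow> 'e \<Rightarrow> 'm tvec" where
  "coord_vec A c p a =
     (\<lambda>f. if smooth_near A p f
          then frechet_derivative (f \<circ> inv_into (fst c) (snd c)) (at (snd c p)) a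
          else 0)"

definition tangent_space :: "('m, 'e::euclidean_space) chart set \<Rightarrow> 'm \<Rightarrow> 'm tvec set" where
  "tangent_space A p = {coord_vec A c p a | c a. c \<in> A \<and> p \<in> fst c}"

text \<open>The components \<open>v(x\<^sup>i)\<close> of \<open>v\<close> with respect to a chart \<open>\<phi> = (x\<^sup>1, \<dots>, x\<^sup>n)\<close>.\<close>

definition components :: "('m \<Rightarrow> 'e::euclidean_space) \<Rightarrow> 'm tvec \<Rightarrow> 'e" where
  "components \<phi> v = (\<Sum>b\<in>Basis. v (\<lambda>q. \<phi> q \<bullet> b) *\<^sub>R b)"

definition tangent_chart ::
  "('m, 'e::euclidean_space) chart set \<Rightarrow> ('m, 'e) chart \<Rightarrow> ('m \<times> 'm tvec, 'e \<times> 'e) chart" where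
  "tangent_chart A c =
     (Sigma (fst c) (tangent_space A), \<lambda>(p, v). (snd c p, components (snd c) v))"

definition tangent_bundle ::
  "('m, 'e::euclidean_space) chart set \<Rightarrow> ('m \<times> 'm tvec, 'e \<times> 'e) chart set" where
  "tangent_bundle A = tangent_chart A ` A"

definition pushforward ::
  "('n, 'd::euclidean_space) chart set \<Rightarrow> ('m \<Rightarrow> 'n) \<Rightarrow> 'm \<Rightarrow> 'm tvec \<Rightarrow> 'n tvec" where
  "pushforward B F p v = (\<lambda>f. if smooth_near B (F p) f then v (f \<circ> F) else 0)"

definition tangent_linear :: "'m tvec set \<Rightarrow> 'n tvec set \<Rightarrow> ('m tvec \<Rightarrow> 'n tvec) \<Rightarrow> bool" where
  "tangent_linear S T L \<longleftrightarrow>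
     (\<forall>u\<in>S. L u \<in> T) \<and>
     (\<forall>u\<in>S. \<forall>v\<in>S. L (tv_add u v) = tv_add (L u) (L v)) \<and>
     (\<forall>a. \<forall>u\<in>S. L (tv_scale a u) = tv_scale a (L u))"


section \<open>Tensor fields\<close>

text \<open>Fields are total functions on the type of points; only their values at points of the
  manifold, and on tangent vectors there, are meaningful.\<close>

definition vector_field :: "('m, 'e::euclidean_space) chart set \<Rightarrow> ('m \<Rightarrow> 'm tvec) \<Rightarrow> bool" where
  "vector_field A X \<longleftrightarrow>
     (\<forall>p\<in>points A. X p \<in> tangent_space A p) \<and>
     (\<forall>(U, \<phi>)\<in>A. smooth_on (\<phi> ` U) (\<lambda>x. components \<phi> (X (inv_into U \<phi> x))))"

definition tensor_field_11 ::
  "('m, 'e::euclidean_space) chart set \<Rightarrow> ('m \<Rightarrow> 'm tvec \<Rightarrow> 'm tvec) \<Rightarrow> bool" where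
  "tensor_field_11 A P \<longleftrightarrow>
     (\<forall>p\<in>points A. tangent_linear (tangent_space A p) (tangent_space A p) (P p)) \<and>
     (\<forall>(U, \<phi>)\<in>A. \<forall>a. smooth_on (\<phi> ` U)
        (\<lambda>x. components \<phi> (P (inv_into U \<phi> x) (coord_vec A (U, \<phi>) (inv_into U \<phi> x) a))))"

definition tensor_field_02 ::
  "('m, 'e::euclidean_space) chart set \<Rightarrow> ('m \<Rightarrow> 'm tvec \<Rightarrow> 'm tvec \<Rightarrow> real) \<Rightarrow> bool" where
  "tensor_field_02 A g \<longleftrightarrow>
     (\<forall>p\<in>points A. \<forall>u\<in>tangent_space A p. \<forall>v\<in>tangent_space A p. \<forall>w\<in>tangent_space A p. \<forall>a.
        g p (tv_add u v) w = g p u w + g p v w \<and>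
        g p w (tv_add u v) = g p w u + g p w v \<and>
        g p (tv_scale a u) w = a * g p u w \<and>
        g p w (tv_scale a u) = a * g p w u) \<and>
     (\<forall>(U, \<phi>)\<in>A. \<forall>a b. smooth_on (\<phi> ` U)
        (\<lambda>x. g (inv_into U \<phi> x) (coord_vec A (U, \<phi>) (inv_into U \<phi> x) a)
                                (coord_vec A (U, \<phi>) (inv_into U \<phi> x) b)))"

text \<open>Constancy of the index of \<open>g\<close>, which some authors require in addition, is not imposed.
  It is automatic for the para-hermitian metrics below: the almost product structure interchanges
  positive and negative definite subspaces, so their index is half the dimension everywhere.\<close>

definition semi_riemannian_metric ::
  "('m, 'e::euclidean_space) chart set \<Rightarrow> ('m \<Rightarrow> 'm tvec \<Rightarrow> 'm tvec \<Rightarrow> real) \<Rightarrow> bool" where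
  "semi_riemannian_metric A g \<longleftrightarrow>
     tensor_field_02 A g \<and>
     (\<forall>p\<in>points A. \<forall>u\<in>tangent_space A p. \<forall>v\<in>tangent_space A p. g p u v = g p v u) \<and>
     (\<forall>p\<in>points A. \<forall>u\<in>tangent_space A p.
        (\<forall>v\<in>tangent_space A p. g p u v = 0) \<longrightarrow> u = (\<lambda>f. 0))"


section \<open>Almost complex, almost product and para-hermitian structures\<close>

definition almost_complex_structure ::
  "('m, 'e::euclidean_space) chart set \<Rightarrow> ('m \<Rightarrow> 'm tvec \<Rightarrow> 'm tvec) \<Rightarrow> bool" where
  "almost_complex_structure A J \<longleftrightarrow>
     tensor_field_11 A J \<and>
     (\<forall>p\<in>points A. \<forall>v\<in>tangent_space A p. J p (J p v) = tv_scale (-1) v)"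

definition almost_product_structure ::
  "('m, 'e::euclidean_space) chart set \<Rightarrow> ('m \<Rightarrow> 'm tvec \<Rightarrow> 'm tvec) \<Rightarrow> bool" where
  "almost_product_structure A P \<longleftrightarrow>
     tensor_field_11 A P \<and>
     (\<forall>p\<in>points A. \<forall>v\<in>tangent_space A p. P p (P p v) = v) \<and>
     \<not> (\<forall>p\<in>points A. \<forall>v\<in>tangent_space A p. P p v = v) \<and>
     \<not> (\<forall>p\<in>points A. \<forall>v\<in>tangent_space A p. P p v = tv_scale (-1) v)"

definition almost_para_hypercomplex ::
  "('m, 'e::euclidean_space) chart set \<Rightarrow>
   ('m \<Rightarrow> 'm tvec \<Rightarrow> 'm tvec) \<times> ('m \<Rightarrow> 'm tvec \<Rightarrow> 'm tvec) \<times> ('m \<Rightarrow> 'm tvec \<Rightarrow> 'm tvec) \<Rightarrow> bool" where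
  "almost_para_hypercomplex A = (\<lambda>(J1, J2, J3).
     smooth_manifold A \<and>
     almost_complex_structure A J1 \<and>
     almost_product_structure A J2 \<and>
     almost_product_structure A J3 \<and>
     (\<forall>p\<in>points A. \<forall>v\<in>tangent_space A p.
        J2 p (J1 p v) = J3 p v \<and> tv_scale (-1) (J1 p (J2 p v)) = J3 p v))"

definition metric_compatible ::
  "('m, 'e::euclidean_space) chart set \<Rightarrow> ('m \<Rightarrow> 'm tvec \<Rightarrow> 'm tvec \<Rightarrow> real) \<Rightarrow> real \<Rightarrow>
   ('m \<Rightarrow> 'm tvec \<Rightarrow> 'm tvec) \<Rightarrow> bool" where
  "metric_compatible A g \<epsilon> J \<longleftrightarrow>
     (\<forall>X Y. vector_field A X \<longrightarrow> vector_field A Y \<longrightarrow>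
        (\<forall>p\<in>points A. g p (J p (X p)) (J p (Y p)) = \<epsilon> * g p (X p) (Y p)))"

definition almost_para_hermitian ::
  "('m, 'e::euclidean_space) chart set \<Rightarrow> ('m \<Rightarrow> 'm tvec \<Rightarrow> 'm tvec) \<Rightarrow>
   ('m \<Rightarrow> 'm tvec \<Rightarrow> 'm tvec \<Rightarrow> real) \<Rightarrow> bool" where
  "almost_para_hermitian A P g \<longleftrightarrow>
     smooth_manifold A \<and>
     almost_product_structure A P \<and>
     semi_riemannian_metric A g \<and>
     metric_compatible A g (-1) P"

definition para_hyperhermitian ::
  "('m, 'e::euclidean_space) chart set \<Rightarrow> ('m \<Rightarrow> 'm tvec \<Rightarrow> 'm tvec \<Rightarrow> real) \<Rightarrow>
   ('m \<Rightarrow> 'm tvec \<Rightarrow> 'm tvec) \<times> ('m \<Rightarrow> 'm tvec \<Rightarrow> 'm tvec) \<times> ('m \<Rightarrow> 'm tvec \<Rightarrow> 'm tvec) \<Rightarrow> bool" where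
  "para_hyperhermitian A G = (\<lambda>(J1, J2, J3).
     metric_compatible A G 1 J1 \<and>
     metric_compatible A G (-1) J2 \<and>
     metric_compatible A G (-1) J3)"


section \<open>The Levi-Civita connection, its connection map and the Sasakian metric\<close>

definition affine_connection ::
  "('m, 'e::euclidean_space) chart set \<Rightarrow>
   (('m \<Rightarrow> 'm tvec) \<Rightarrow> ('m \<Rightarrow> 'm tvec) \<Rightarrow> ('m \<Rightarrow> 'm tvec)) \<Rightarrow> bool" where
  "affine_connection A D \<longleftrightarrow>
     (\<forall>X Y. vector_field A X \<longrightarrow> vector_field A Y \<longrightarrow> vector_field A (D X Y)) \<and>
     (\<forall>X Y Z f. vector_field A X \<longrightarrow> vector_field A Y \<longrightarrow> vector_field A Z \<longrightarrow> smooth_fun A f \<longrightarrow>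
        (\<forall>p\<in>points A.
           D (\<lambda>q. tv_add (X q) (Y q)) Z p = tv_add (D X Z p) (D Y Z p) \<and>
           D (\<lambda>q. tv_scale (f q) (X q)) Z p = tv_scale (f p) (D X Z p) \<and>
           D X (\<lambda>q. tv_add (Y q) (Z q)) p = tv_add (D X Y p) (D X Z p) \<and>
           D X (\<lambda>q. tv_scale (f q) (Y q)) p =
             tv_add (tv_scale (f p) (D X Y p)) (tv_scale (X p f) (Y p))))"

definition lie_bracket ::
  "('m, 'e::euclidean_space) chart set \<Rightarrow> ('m \<Rightarrow> 'm tvec) \<Rightarrow> ('m \<Rightarrow> 'm tvec) \<Rightarrow> 'm \<Rightarrow> 'm tvec" where
  "lie_bracket A X Y p =
     (\<lambda>f. if smooth_near A p f then X p (\<lambda>q. Y q f) - Y p (\<lambda>q. X q f) else 0)"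

definition levi_civita_connection ::
  "('m, 'e::euclidean_space) chart set \<Rightarrow> ('m \<Rightarrow> 'm tvec \<Rightarrow> 'm tvec \<Rightarrow> real) \<Rightarrow>
   (('m \<Rightarrow> 'm tvec) \<Rightarrow> ('m \<Rightarrow> 'm tvec) \<Rightarrow> ('m \<Rightarrow> 'm tvec)) \<Rightarrow> bool" where
  "levi_civita_connection A g D \<longleftrightarrow>
     affine_connection A D \<and>
     (\<forall>X Y. vector_field A X \<longrightarrow> vector_field A Y \<longrightarrow>
        (\<forall>p\<in>points A. tv_add (D X Y p) (tv_scale (-1) (D Y X p)) = lie_bracket A X Y p)) \<and>
     (\<forall>X Y Z. vector_field A X \<longrightarrow> vector_field A Y \<longrightarrow> vector_field A Z \<longrightarrow>
        (\<forall>p\<in>points A.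
           X p (\<lambda>q. g q (Y q) (Z q)) = g p (D X Y p) (Z p) + g p (Y p) (D X Z p)))"

text \<open>The connection map sends \<open>T\<^sub>t(TM)\<close> linearly to the tangent space at \<open>\<pi>(t)\<close> and satisfies
  \<open>K(Z\<^sub>*X) = \<nabla>\<^sub>X Z\<close> for all vector fields, where \<open>Z\<close> is regarded as a section \<open>M \<rightarrow> TM\<close>. The vectors
  \<open>Z\<^sub>*X\<close> with \<open>Z(p) = t\<close> span \<open>T\<^sub>t(TM)\<close>, so this determines \<open>K\<close>; in coordinates
  \<open>K(x, u; a, b) = (x; b + \<Gamma>\<^sub>x(a, u))\<close>.\<close>

definition connection_map ::
  "('m, 'e::euclidean_space) chart set \<Rightarrow>
   (('m \<Rightarrow> 'm tvec) \<Rightarrow> ('m \<Rightarrow> 'm tvec) \<Rightarrow> ('m \<Rightarrow> 'm tvec)) \<Rightarrow>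
   ('m \<times> 'm tvec \<Rightarrow> ('m \<times> 'm tvec) tvec \<Rightarrow> 'm tvec) \<Rightarrow> bool" where
  "connection_map A D K \<longleftrightarrow>
     (\<forall>t\<in>points (tangent_bundle A).
        tangent_linear (tangent_space (tangent_bundle A) t) (tangent_space A (fst t)) (K t)) \<and>
     (\<forall>X Z. vector_field A X \<longrightarrow> vector_field A Z \<longrightarrow>
        (\<forall>p\<in>points A.
           K (p, Z p) (pushforward (tangent_bundle A) (\<lambda>q. (q, Z q)) p (X p)) = D X Z p))"

text \<open>\<open>sasakian_metric A g G\<close> states that \<open>G\<close> is the Sasakian metric determined by \<open>g\<close>. The
  Levi-Civita connection and its connection map exist and are unique (up to values outside the
  manifold and its tangent spaces), so this determines \<open>G\<close> on \<open>TM\<close>.\<close>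

definition sasakian_metric ::
  "('m, 'e::euclidean_space) chart set \<Rightarrow> ('m \<Rightarrow> 'm tvec \<Rightarrow> 'm tvec \<Rightarrow> real) \<Rightarrow>
   ('m \<times> 'm tvec \<Rightarrow> ('m \<times> 'm tvec) tvec \<Rightarrow> ('m \<times> 'm tvec) tvec \<Rightarrow> real) \<Rightarrow> bool" where
  "sasakian_metric A g G \<longleftrightarrow>
     (\<exists>D K. levi_civita_connection A g D \<and> connection_map A D K \<and>
        (\<forall>t\<in>points (tangent_bundle A).
           \<forall>X\<in>tangent_space (tangent_bundle A) t. \<forall>Y\<in>tangent_space (tangent_bundle A) t.
             G t X Y = g (fst t) (K t X) (K t Y) +
                       g (fst t) (pushforward A fst t X) (pushforward A fst t Y)))"

end

theory Submission
  imports Defs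
begin

text \<open>
  The Levi-Civita connection splits every tangent space of \<open>TM\<close>: for \<open>t\<close> over \<open>p\<close>, the map
  \<open>Y \<mapsto> (\<pi>\<^sub>*Y, KY)\<close> is an isomorphism from \<open>T\<^sub>t(TM)\<close> onto \<open>T\<^sub>pM \<oplus> T\<^sub>pM\<close>, which is \<open>\<real>\<^sup>2 \<otimes> T\<^sub>pM\<close>,
  and it carries the Sasakian metric to the tensor product of the Euclidean metric with \<open>g\<close>.
  So a real \<open>2 \<times> 2\<close> matrix \<open>m\<close> and a tensor field \<open>Q\<close> on \<open>M\<close> give an operator \<open>m \<otimes> Q\<close> on \<open>TM\<close>
  (\<open>split_op\<close>). Such operators multiply by \<open>(m \<otimes> Q) (n \<otimes> R) = mn \<otimes> QR\<close>, and if \<open>m\<close> is orthogonal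
  and \<open>Q\<close> multiplies \<open>g\<close> by \<open>\<epsilon>\<close>, then \<open>m \<otimes> Q\<close> multiplies \<open>G\<close> by \<open>\<epsilon>\<close>
  (\<open>split_op_compose\<close>, \<open>split_op_metric_compatible\<close>). The structure sought is
  \<open>J\<^sub>1(h, k) = (-k, h)\<close>, \<open>J\<^sub>2(h, k) = (Ph, -Pk)\<close>, \<open>J\<^sub>3(h, k) = (-Pk, -Ph)\<close>, that is, a rotation
  tensored with \<open>Id\<close> and two reflections tensored with \<open>P\<close>; all identities between the three reduce
  to products of \<open>2 \<times> 2\<close> matrices and \<open>P\<^sup>2 = Id\<close>.

  What remains is that the splitting is an isomorphism and that the operators are smooth. Both follow
  from the coordinate formula \<open>K(x, u; a, b) = (x; b + \<Gamma>\<^sub>x(a, u))\<close> with \<open>\<Gamma>\<close> smooth in \<open>x\<close> and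
  bilinear (\<open>K_coords\<close>, \<open>christoffel_smooth\<close>). Since \<open>K\<close> and the connection are characterised by their
  values on global vector fields, the formula is obtained by multiplying coordinate fields by bump
  functions. These exist because \<open>M\<close> is Hausdorff, and they also turn the compatibility of \<open>g\<close> with
  \<open>P\<close> from a statement about vector fields into one about tangent vectors. The bundle \<open>TM\<close> is
  itself a manifold (\<open>smooth_manifold_tangent_bundle\<close>), because Hausdorff separation and a countable
  cover by chart domains both lift along \<open>\<pi>\<close>.
\<close>

section \<open>Calculus of smooth maps\<close>

lemma C_k_on_subset: "C_k_on k S f \<Longrightarrow> T \<subseteq> S \<Longrightarrow> C_k_on k T f"
  by (induction k arbitrary: f) (auto intro: continuous_on_subset)

lemma C_k_on_Suc_has_derivative:
  "C_k_on (Suc k) S f \<Longrightarrow> x \<in> S \<Longrightarrow> (f has_derivative frechet_derivative f (at x)) (at x)"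
  by (simp add: frechet_derivative_works)

lemma C_k_on_cong:
  assumes "open S" "\<And>x. x \<in> S \<Longrightarrow> f x = g x" "C_k_on k S f"
  shows "C_k_on k S g"
  using assms(2,3)
proof (induction k arbitrary: f g)
  case 0
  then show ?case by (simp cong: continuous_on_cong)
next
  case (Suc k)
  have der: "(g has_derivative frechet_derivative f (at x)) (at x)" if "x \<in> S" for x
    by (rule has_derivative_transform_within_open[OF C_k_on_Suc_has_derivative[OF Suc.prems(2) that]
          assms(1) that]) (use Suc.prems(1) in auto)
  have "C_k_on k S (\<lambda>x. frechet_derivative g (at x) v)" for v
    by (rule Suc.IH[of "\<lambda>x. frechet_derivative f (at x) v"])
      (use Suc.prems(2) frechet_derivative_at[OF der] in auto)
  then show ?case using der by (auto simp: differentiable_def)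
qed

lemma C_k_on_SucI:
  assumes "open S" "\<And>x. x \<in> S \<Longrightarrow> (f has_derivative f' x) (at x)" "\<And>v. C_k_on k S (\<lambda>x. f' x v)"
  shows "C_k_on (Suc k) S f"
proof -
  have "C_k_on k S (\<lambda>x. frechet_derivative f (at x) v)" for v
    by (rule C_k_on_cong[OF assms(1) _ assms(3)[of v]]) (use frechet_derivative_at[OF assms(2)] in auto)
  then show ?thesis using assms(2) by (auto simp: differentiable_def)
qed

lemma C_k_on_local:
  assumes "\<And>x. x \<in> S \<Longrightarrow> \<exists>T. open T \<and> x \<in> T \<and> C_k_on k T f"
  shows "C_k_on k S f"
  using assms
proof (induction k arbitrary: f)
  case 0
  then have "isCont f x" if "x \<in> S" for x
    using that by (metis C_k_on.simps(1) continuous_on_eq_continuous_at)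
  then show ?case by (simp add: continuous_at_imp_continuous_on)
next
  case (Suc k)
  have "f differentiable (at x)" if "x \<in> S" for x
    using Suc.prems[OF that] by auto
  moreover have "C_k_on k S (\<lambda>x. frechet_derivative f (at x) v)" for v
    by (rule Suc.IH) (use Suc.prems in fastforce)
  ultimately show ?case by simp
qed

lemma C_k_on_Suc_imp: "C_k_on (Suc k) S f \<Longrightarrow> C_k_on k S f"
proof (induction k arbitrary: f)
  case 0
  then show ?case
    by (auto intro!: continuous_at_imp_continuous_on differentiable_imp_continuous_within)
next
  case (Suc k)
  then show ?case by (metis C_k_on.simps(2))
qed

lemma C_k_on_const: "C_k_on k S (\<lambda>x. c)"
  by (induction k arbitrary: c) (auto simp: frechet_derivative_const)

lemma C_k_on_add:
  assumes "open S" "C_k_on k S f" "C_k_on k S g"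
  shows "C_k_on k S (\<lambda>x. f x + g x)"
  using assms(2,3)
proof (induction k arbitrary: f g)
  case 0
  then show ?case by (auto intro: continuous_on_add)
next
  case (Suc k)
  show ?case
    by (rule C_k_on_SucI[OF assms(1) has_derivative_add[OF C_k_on_Suc_has_derivative[OF Suc.prems(1)]
            C_k_on_Suc_has_derivative[OF Suc.prems(2)]]]) (use Suc in auto)
qed

lemma C_k_on_bounded_linear:
  assumes "bounded_linear L" "open S" "C_k_on k S f"
  shows "C_k_on k S (\<lambda>x. L (f x))"
  using assms(3)
proof (induction k arbitrary: f)
  case 0
  then show ?case using assms(1) by (auto intro: bounded_linear.continuous_on)
next
  case (Suc k)
  show ?case
    by (rule C_k_on_SucI[OF assms(2) bounded_linear.has_derivative[OF assms(1)
            C_k_on_Suc_has_derivative[OF Suc.prems(1)]]]) (use Suc in auto)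
qed

lemma C_k_on_bounded_bilinear:
  assumes "bounded_bilinear pr" "open S" "C_k_on k S f" "C_k_on k S g"
  shows "C_k_on k S (\<lambda>x. pr (f x) (g x))"
  using assms(3,4)
proof (induction k arbitrary: f g)
  case 0
  then show ?case using assms(1) by (auto intro: bounded_bilinear.continuous_on)
next
  case (Suc k)
  show ?case
  proof (rule C_k_on_SucI[OF assms(2) bounded_bilinear.FDERIV[OF assms(1)
            C_k_on_Suc_has_derivative[OF Suc.prems(1)] C_k_on_Suc_has_derivative[OF Suc.prems(2)]]])
    show "C_k_on k S (\<lambda>x. pr (f x) (frechet_derivative g (at x) v) + pr (frechet_derivative f (at x) v) (g x))" for v
      by (intro C_k_on_add assms(2) Suc.IH C_k_on_Suc_imp[OF Suc.prems(1)] C_k_on_Suc_imp[OF Suc.prems(2)])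
        (use Suc.prems in auto)
  qed auto
qed

lemma C_k_on_sum:
  "open S \<Longrightarrow> (\<And>i. i \<in> I \<Longrightarrow> C_k_on k S (f i)) \<Longrightarrow> C_k_on k S (\<lambda>x. \<Sum>i\<in>I. f i x)"
  by (induction I rule: infinite_finite_induct) (auto intro: C_k_on_const C_k_on_add)

lemma linear_eq_sum_Basis:
  fixes x :: "'a::euclidean_space"
  assumes "linear L"
  shows "L x = (\<Sum>b\<in>Basis. (x \<bullet> b) *\<^sub>R L b)"
  by (subst euclidean_representation[of x, symmetric]) (simp add: linear_sum[OF assms] linear_cmul[OF assms])

text \<open>The chain rule expresses the derivative of the composition through partial derivatives, which
  are of lower order; this is where the intermediate space has to be finite-dimensional.\<close>

lemma C_k_on_compose:
  fixes f :: "'a::real_normed_vector \<Rightarrow> 'b::euclidean_space" and g :: "'b \<Rightarrow> 'c::real_normed_vector"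
  assumes "open S" "f ` S \<subseteq> T" "C_k_on k S f" "C_k_on k T g"
  shows "C_k_on k S (\<lambda>x. g (f x))"
  using assms(3,4)
proof (induction k arbitrary: g)
  case 0
  then show ?case using assms(2) by (auto intro: continuous_on_compose2)
next
  case (Suc k)
  let ?f' = "\<lambda>x. frechet_derivative f (at x)" and ?g' = "\<lambda>y. frechet_derivative g (at y)"
  have f: "(f has_derivative ?f' x) (at x)" if "x \<in> S" for x
    using C_k_on_Suc_has_derivative[OF Suc.prems(1) that] .
  have g: "(g has_derivative ?g' y) (at y)" if "y \<in> T" for y
    using C_k_on_Suc_has_derivative[OF Suc.prems(2) that] .
  show ?case
  proof (rule C_k_on_SucI[OF assms(1)])
    show "((\<lambda>x. g (f x)) has_derivative (\<lambda>v. \<Sum>b\<in>Basis. (?f' x v \<bullet> b) *\<^sub>R ?g' (f x) b)) (at x)"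
      if "x \<in> S" for x
    proof -
      have "f x \<in> T" using that assms(2) by auto
      have "((\<lambda>x. g (f x)) has_derivative (\<lambda>v. ?g' (f x) (?f' x v))) (at x)"
        by (rule has_derivative_compose[OF f[OF that] g[OF \<open>f x \<in> T\<close>]])
      then show ?thesis
        by (subst (asm) linear_eq_sum_Basis[OF has_derivative_linear[OF g[OF \<open>f x \<in> T\<close>]]])
    qed
    show "C_k_on k S (\<lambda>x. \<Sum>b\<in>Basis. (?f' x v \<bullet> b) *\<^sub>R ?g' (f x) b)" for v
      by (intro C_k_on_sum assms(1) C_k_on_bounded_bilinear[OF bounded_bilinear_scaleR]
          C_k_on_bounded_linear[OF bounded_linear_inner_left] Suc.IH C_k_on_Suc_imp[OF Suc.prems(1)])
        (use Suc.prems in auto)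
  qed
qed

text \<open>The derivative \<open>- f' / f\<^sup>2\<close> contains only \<open>1 / f\<close> itself and \<open>f'\<close>, so the order of
  differentiability can be raised one step at a time.\<close>

lemma C_k_on_inverse:
  fixes f :: "'a::real_normed_vector \<Rightarrow> real"
  assumes "open S" "\<And>x. x \<in> S \<Longrightarrow> f x \<noteq> 0" "C_k_on k S f"
  shows "C_k_on k S (\<lambda>x. inverse (f x))"
  using assms(3)
proof (induction k)
  case 0
  then show ?case using assms(2) by (auto intro: continuous_on_inverse)
next
  case (Suc k)
  have IH: "C_k_on k S (\<lambda>x. inverse (f x))"
    using Suc.IH C_k_on_Suc_imp[OF Suc.prems] by blast
  show ?case
  proof (rule C_k_on_SucI[OF assms(1)])
    show "((\<lambda>x. inverse (f x)) has_derivative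
        (\<lambda>v. - (inverse (f x) * frechet_derivative f (at x) v * inverse (f x)))) (at x)" if "x \<in> S" for x
      by (rule Deriv.has_derivative_inverse[OF assms(2)[OF that] C_k_on_Suc_has_derivative[OF Suc.prems that]])
    show "C_k_on k S (\<lambda>x. - (inverse (f x) * frechet_derivative f (at x) v * inverse (f x)))" for v
      by (intro C_k_on_bounded_linear[OF bounded_linear_minus[OF bounded_linear_ident]] assms(1)
          C_k_on_bounded_bilinear[OF bounded_bilinear_mult] IH) (use Suc.prems in auto)
  qed
qed

lemma C_k_on_ident: "open S \<Longrightarrow> C_k_on k S (\<lambda>x. x)"
proof (induction k)
  case (Suc k)
  show ?case by (rule C_k_on_SucI[OF Suc.prems has_derivative_ident C_k_on_const])
qed (auto intro: continuous_on_id)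

lemma smooth_on_subset: "smooth_on S f \<Longrightarrow> T \<subseteq> S \<Longrightarrow> smooth_on T f"
  unfolding smooth_on_def by (blast intro: C_k_on_subset)

lemma smooth_on_cong:
  "open S \<Longrightarrow> (\<And>x. x \<in> S \<Longrightarrow> f x = g x) \<Longrightarrow> smooth_on S f \<Longrightarrow> smooth_on S g"
  unfolding smooth_on_def using C_k_on_cong by blast

lemma smooth_on_local:
  "(\<And>x. x \<in> S \<Longrightarrow> \<exists>T. open T \<and> x \<in> T \<and> smooth_on T f) \<Longrightarrow> smooth_on S f"
  unfolding smooth_on_def by (intro allI C_k_on_local) meson

lemma smooth_on_has_derivative:
  "smooth_on S f \<Longrightarrow> x \<in> S \<Longrightarrow> (f has_derivative frechet_derivative f (at x)) (at x)"
  unfolding smooth_on_def by (blast intro: C_k_on_Suc_has_derivative)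

lemma smooth_on_continuous: "smooth_on S f \<Longrightarrow> continuous_on S f"
  unfolding smooth_on_def by (metis C_k_on.simps(1))

lemma smooth_on_derivative: "smooth_on S f \<Longrightarrow> smooth_on S (\<lambda>x. frechet_derivative f (at x) v)"
  unfolding smooth_on_def by (metis C_k_on.simps(2))

lemma smooth_on_const: "smooth_on S (\<lambda>x. c)"
  unfolding smooth_on_def by (simp add: C_k_on_const)

lemma smooth_on_ident: "open S \<Longrightarrow> smooth_on S (\<lambda>x. x)"
  unfolding smooth_on_def by (simp add: C_k_on_ident)

lemma smooth_on_add: "open S \<Longrightarrow> smooth_on S f \<Longrightarrow> smooth_on S g \<Longrightarrow> smooth_on S (\<lambda>x. f x + g x)"
  unfolding smooth_on_def by (simp add: C_k_on_add)

lemma smooth_on_sum: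
  "open S \<Longrightarrow> (\<And>i. i \<in> I \<Longrightarrow> smooth_on S (f i)) \<Longrightarrow> smooth_on S (\<lambda>x. \<Sum>i\<in>I. f i x)"
  unfolding smooth_on_def by (simp add: C_k_on_sum)

lemma smooth_on_bounded_linear:
  "bounded_linear L \<Longrightarrow> open S \<Longrightarrow> smooth_on S f \<Longrightarrow> smooth_on S (\<lambda>x. L (f x))"
  unfolding smooth_on_def by (simp add: C_k_on_bounded_linear)

lemma smooth_on_bounded_bilinear:
  "bounded_bilinear pr \<Longrightarrow> open S \<Longrightarrow> smooth_on S f \<Longrightarrow> smooth_on S g \<Longrightarrow> smooth_on S (\<lambda>x. pr (f x) (g x))"
  unfolding smooth_on_def by (simp add: C_k_on_bounded_bilinear)

lemma smooth_on_compose: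
  fixes f :: "'a::real_normed_vector \<Rightarrow> 'b::euclidean_space" and g :: "'b \<Rightarrow> 'c::real_normed_vector"
  shows "open S \<Longrightarrow> f ` S \<subseteq> T \<Longrightarrow> smooth_on S f \<Longrightarrow> smooth_on T g \<Longrightarrow> smooth_on S (\<lambda>x. g (f x))"
  unfolding smooth_on_def using C_k_on_compose by blast

lemma smooth_on_inverse:
  fixes f :: "'a::real_normed_vector \<Rightarrow> real"
  shows "open S \<Longrightarrow> (\<And>x. x \<in> S \<Longrightarrow> f x \<noteq> 0) \<Longrightarrow> smooth_on S f \<Longrightarrow> smooth_on S (\<lambda>x. inverse (f x))"
  unfolding smooth_on_def by (simp add: C_k_on_inverse)

lemmas smooth_on_scaleR = smooth_on_bounded_bilinear[OF bounded_bilinear_scaleR]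
lemmas smooth_on_mult = smooth_on_bounded_bilinear[OF bounded_bilinear_mult]
lemmas smooth_on_inner = smooth_on_bounded_bilinear[OF bounded_bilinear_inner]
lemmas smooth_on_fst = smooth_on_bounded_linear[OF bounded_linear_fst]
lemmas smooth_on_snd = smooth_on_bounded_linear[OF bounded_linear_snd]

lemma smooth_on_minus: "open S \<Longrightarrow> smooth_on S f \<Longrightarrow> smooth_on S (\<lambda>x. - f x)"
  using smooth_on_bounded_linear[OF bounded_linear_minus[OF bounded_linear_ident]] .

lemma smooth_on_diff: "open S \<Longrightarrow> smooth_on S f \<Longrightarrow> smooth_on S g \<Longrightarrow> smooth_on S (\<lambda>x. f x - g x)"
  using smooth_on_add[OF _ _ smooth_on_minus, of S f g] by simp

lemma smooth_on_Pair:
  assumes "open S" "smooth_on S f" "smooth_on S g"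
  shows "smooth_on S (\<lambda>x. (f x, g x))"
proof -
  have "smooth_on S (\<lambda>x. (f x, 0) + (0, g x))"
    by (intro smooth_on_add assms smooth_on_bounded_linear[of "\<lambda>y. (y, 0)"]
        smooth_on_bounded_linear[of "\<lambda>y. (0, y)"] bounded_linear_Pair bounded_linear_ident bounded_linear_zero)
  then show ?thesis by simp
qed

text \<open>Expand the argument in the standard basis. Differentials \<open>D\<tau>\<^sub>x a\<close>, Christoffel symbols and
  tensor fields are all of this form.\<close>

lemma smooth_on_linear_family:
  fixes w :: "'a::real_normed_vector \<Rightarrow> 'b::euclidean_space"
  assumes "open S" "\<And>x. x \<in> S \<Longrightarrow> linear (L x)" "\<And>b. smooth_on S (\<lambda>x. L x b)" "smooth_on S w"
  shows "smooth_on S (\<lambda>x. L x (w x))"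
proof (rule smooth_on_cong[OF assms(1)])
  show "(\<Sum>b\<in>Basis. (w x \<bullet> b) *\<^sub>R L x b) = L x (w x)" if "x \<in> S" for x
    by (rule linear_eq_sum_Basis[OF assms(2)[OF that], symmetric])
  show "smooth_on S (\<lambda>x. \<Sum>b\<in>Basis. (w x \<bullet> b) *\<^sub>R L x b)"
    by (intro smooth_on_sum smooth_on_scaleR smooth_on_inner smooth_on_const assms)
qed


section \<open>Bump functions on Euclidean spaces\<close>

text \<open>The functions \<open>exp (-1/s) / s\<^sup>n\<close>, extended by \<open>0\<close>, form a family that is closed under
  differentiation up to linear combinations; hence all its members are smooth.\<close>

definition flat :: "nat \<Rightarrow> real \<Rightarrow> real" where
  "flat n s = (if s > 0 then exp (- 1 / s) / s ^ n else 0)"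

lemma flat_DERIV: "(flat n has_real_derivative (flat (n + 2) s - n * flat (n + 1) s)) (at s)"
proof -
  consider "s > 0" | "s < 0" | "s = 0" by linarith
  then show ?thesis
  proof cases
    case 1
    have "((\<lambda>s. exp (- 1 / s) / s ^ n) has_real_derivative
        (exp (- 1 / s) * (1 / s\<^sup>2) * s ^ n - exp (- 1 / s) * (real n * s ^ (n - 1))) / (s ^ n * s ^ n)) (at s)"
      using 1 by (auto intro!: derivative_eq_intros simp: power2_eq_square)
    moreover have p: "real n * s ^ (n - 1) = real n * s ^ n / s"
      using 1 by (cases n) auto
    have "(exp (- 1 / s) * (1 / s\<^sup>2) * s ^ n - exp (- 1 / s) * (real n * s ^ (n - 1))) / (s ^ n * s ^ n)
        = flat (n + 2) s - n * flat (n + 1) s"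
      unfolding p using 1 by (simp add: flat_def field_simps power2_eq_square)
    ultimately have d: "((\<lambda>s. exp (- 1 / s) / s ^ n) has_real_derivative
        (flat (n + 2) s - n * flat (n + 1) s)) (at s)"
      by simp
    show ?thesis
      by (rule has_field_derivative_transform_within_open[OF d, of "{0<..}"]) (use 1 in \<open>auto simp: flat_def\<close>)
  next
    case 2
    show ?thesis
      by (rule has_field_derivative_transform_within_open[of "\<lambda>_. 0" _ _ "{..<0}"])
        (use 2 in \<open>auto simp: flat_def\<close>)
  next
    case 3
    have "((\<lambda>h. (inverse h) ^ (n + 1) / exp (inverse h)) \<longlongrightarrow> (0::real)) (at_right 0)"
      by (rule filterlim_compose[OF tendsto_power_div_exp_0 filterlim_inverse_at_top_right])
    then have "((\<lambda>h. (flat n h - flat n 0) / (h - 0)) \<longlongrightarrow> 0) (at_right 0)"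
      by (rule Lim_transform_eventually)
        (auto simp: flat_def eventually_at_right_field exp_minus field_simps intro!: exI[of _ 1])
    moreover have "((\<lambda>h. (flat n h - flat n 0) / (h - 0)) \<longlongrightarrow> 0) (at_left 0)"
      by (rule Lim_transform_eventually[OF tendsto_const])
        (auto simp: flat_def eventually_at_left_field intro!: exI[of _ "-1"])
    ultimately have "((\<lambda>h. (flat n h - flat n 0) / (h - 0)) \<longlongrightarrow> 0) (at 0)"
      by (simp add: filterlim_split_at)
    then show ?thesis unfolding 3 has_field_derivative_iff by (simp add: flat_def)
  qed
qed

lemma smooth_flat: "smooth_on S (flat n)"
proof -
  have "C_k_on k UNIV (flat n)" for k
  proof (induction k arbitrary: n)
    case 0
    show ?case using flat_DERIV by (auto intro!: continuous_at_imp_continuous_on DERIV_isCont)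
  next
    case (Suc k)
    show ?case
    proof (rule C_k_on_SucI[OF open_UNIV])
      show "(flat n has_derivative (\<lambda>v. (flat (n + 2) s + (- real n) * flat (n + 1) s) * v)) (at s)" for s
        using flat_DERIV[of n s] by (simp add: has_field_derivative_def)
      show "C_k_on k UNIV (\<lambda>s. (flat (n + 2) s + (- real n) * flat (n + 1) s) * v)" for v
        by (intro C_k_on_bounded_bilinear[OF bounded_bilinear_mult] C_k_on_add C_k_on_const Suc.IH open_UNIV)
    qed
  qed
  then show ?thesis unfolding smooth_on_def by (blast intro: C_k_on_subset)
qed

lemma euclidean_bump:
  fixes c :: "'a::euclidean_space"
  assumes "r > 0"
  obtains f :: "'a \<Rightarrow> real" where "smooth_on UNIV f" "\<And>x. dist c x < r \<Longrightarrow> f x = 1"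
    "\<And>x. dist c x \<ge> 2 * r \<Longrightarrow> f x = 0"
proof -
  define q where "q x = (x - c) \<bullet> (x - c)" for x
  \<comment> \<open>The first summand of the denominator vanishes outside the large ball, the second one inside the
    small ball, and never both.\<close>
  define f where "f x = flat 0 ((2 * r)\<^sup>2 - q x) * inverse (flat 0 ((2 * r)\<^sup>2 - q x) + flat 0 (q x - r\<^sup>2))" for x
  have q: "q x = (dist c x)\<^sup>2" for x
    unfolding q_def by (subst dist_commute) (simp add: dist_norm power2_norm_eq_inner)
  have qs: "smooth_on UNIV q"
    unfolding q_def by (intro smooth_on_inner smooth_on_diff smooth_on_ident smooth_on_const open_UNIV)
  have pos: "flat 0 ((2 * r)\<^sup>2 - q x) + flat 0 (q x - r\<^sup>2) \<noteq> 0" for x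
  proof -
    have "r\<^sup>2 < (2 * r)\<^sup>2" using assms by (simp add: power_mult_distrib)
    then have "(2 * r)\<^sup>2 - q x > 0 \<or> q x - r\<^sup>2 > 0" by linarith
    then show ?thesis unfolding flat_def using exp_gt_zero[of "- 1 / ((2 * r)\<^sup>2 - q x)"] exp_gt_zero[of "- 1 / (q x - r\<^sup>2)"]
      by (smt (verit) power_0 div_by_1)
  qed
  have "smooth_on UNIV f"
    unfolding f_def
    by (intro smooth_on_mult smooth_on_inverse smooth_on_add smooth_on_compose[OF _ _ _ smooth_flat, where T=UNIV]
        smooth_on_diff smooth_on_const qs open_UNIV pos) auto
  moreover have "f x = 1" if "dist c x < r" for x
  proof -
    have "q x < r\<^sup>2" unfolding q using that by (simp add: power_strict_mono)
    moreover have "flat 0 (q x - r\<^sup>2) = 0" using \<open>q x < r\<^sup>2\<close> by (simp add: flat_def)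
    ultimately show ?thesis using pos[of x] unfolding f_def by simp
  qed
  moreover have "f x = 0" if "dist c x \<ge> 2 * r" for x
  proof -
    have "q x \<ge> (2 * r)\<^sup>2" unfolding q using that assms by (intro power_mono) auto
    then show ?thesis unfolding f_def by (simp add: flat_def)
  qed
  ultimately show ?thesis using that by blast
qed

section \<open>Atlases and their topology\<close>

locale atlas =
  fixes A :: "('m, 'e::euclidean_space) chart set"
  assumes smooth_atlas: "smooth_atlas A"
begin

lemma chart_inj: "(U, \<phi>) \<in> A \<Longrightarrow> inj_on \<phi> U"
  using smooth_atlas unfolding smooth_atlas_def by auto

lemma chart_open_image: "(U, \<phi>) \<in> A \<Longrightarrow> open (\<phi> ` U)"
  using smooth_atlas unfolding smooth_atlas_def by auto

lemma open_overlap: "(U, \<phi>) \<in> A \<Longrightarrow> (V, \<psi>) \<in> A \<Longrightarrow> open (\<phi> ` (U \<inter> V))"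
  using smooth_atlas unfolding smooth_atlas_def by blast

lemma smooth_transition:
  "(U, \<phi>) \<in> A \<Longrightarrow> (V, \<psi>) \<in> A \<Longrightarrow> smooth_on (\<phi> ` (U \<inter> V)) (\<psi> \<circ> inv_into U \<phi>)"
  using smooth_atlas unfolding smooth_atlas_def by blast

lemma chart_inv: "(U, \<phi>) \<in> A \<Longrightarrow> p \<in> U \<Longrightarrow> inv_into U \<phi> (\<phi> p) = p"
  by (simp add: chart_inj)

lemma chart_subset_points: "(U, \<phi>) \<in> A \<Longrightarrow> U \<subseteq> points A"
  unfolding points_def by force

lemma points_chart:
  assumes "p \<in> points A" obtains U \<phi> where "(U, \<phi>) \<in> A" "p \<in> U"
  using assms unfolding points_def by force

lemma openin_atlas_iff:
  "openin (atlas_topology A) W \<longleftrightarrow> W \<subseteq> points A \<and> (\<forall>(U, \<phi>)\<in>A. open (\<phi> ` (W \<inter> U)))"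
proof -
  have "istopology (\<lambda>W. W \<subseteq> points A \<and> (\<forall>(U, \<phi>)\<in>A. open (\<phi> ` (W \<inter> U))))"
    unfolding istopology_def
  proof safe
    fix S T U \<phi> assume *: "\<forall>(U, \<phi>)\<in>A. open (\<phi> ` (S \<inter> U))" "\<forall>(U, \<phi>)\<in>A. open (\<phi> ` (T \<inter> U))" "(U, \<phi>) \<in> A"
    have "\<phi> ` (S \<inter> T \<inter> U) = \<phi> ` (S \<inter> U) \<inter> \<phi> ` (T \<inter> U)"
      using chart_inj[OF *(3)] by (auto simp: inj_on_def)
    then show "open (\<phi> ` (S \<inter> T \<inter> U))" using * by auto
  next
    fix K U \<phi> assume *: "\<forall>W\<in>K. W \<subseteq> points A \<and> (\<forall>(U, \<phi>)\<in>A. open (\<phi> ` (W \<inter> U)))" "(U, \<phi>) \<in> A"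
    have "\<phi> ` (\<Union>K \<inter> U) = (\<Union>W\<in>K. \<phi> ` (W \<inter> U))" by auto
    moreover have "open (\<phi> ` (W \<inter> U))" if "W \<in> K" for W using * that by fast
    ultimately show "open (\<phi> ` (\<Union>K \<inter> U))" by auto
  qed auto
  then show ?thesis unfolding atlas_topology_def by simp
qed

lemma openin_chart: "(U, \<phi>) \<in> A \<Longrightarrow> openin (atlas_topology A) U"
  unfolding openin_atlas_iff using chart_subset_points open_overlap by (auto simp: Int_commute)

lemma topspace_atlas [simp]: "topspace (atlas_topology A) = points A"
proof
  show "topspace (atlas_topology A) \<subseteq> points A"
    using openin_atlas_iff openin_topspace by blast
  show "points A \<subseteq> topspace (atlas_topology A)"
    by (metis openin_chart openin_subset points_chart subset_iff)
qed

lemma openin_chart_preimage: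
  assumes "(U, \<phi>) \<in> A" "open S"
  shows "openin (atlas_topology A) {p \<in> U. \<phi> p \<in> S}"
  unfolding openin_atlas_iff
proof safe
  fix p assume "p \<in> U" then show "p \<in> points A" using assms chart_subset_points by auto
next
  fix V \<psi> assume V: "(V, \<psi>) \<in> A"
  have "\<psi> ` ({p \<in> U. \<phi> p \<in> S} \<inter> V) = \<psi> ` (V \<inter> U) \<inter> (\<phi> \<circ> inv_into V \<psi>) -` S"
    using chart_inv[OF V] by force
  moreover have "open \<dots>"
    using open_overlap[OF V assms(1)] smooth_on_continuous[OF smooth_transition[OF V assms(1)]] assms(2)
    by (simp add: continuous_open_preimage)
  ultimately show "open (\<psi> ` ({p \<in> U. \<phi> p \<in> S} \<inter> V))" by simp
qed

lemma openin_image_chart: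
  "openin (atlas_topology A) W \<Longrightarrow> (U, \<phi>) \<in> A \<Longrightarrow> open (\<phi> ` (W \<inter> U))"
  unfolding openin_atlas_iff by auto

lemma continuous_map_chart_inv:
  assumes "(U, \<phi>) \<in> A"
  shows "continuous_map (top_of_set (\<phi> ` U)) (atlas_topology A) (inv_into U \<phi>)"
  unfolding continuous_map
proof (intro conjI allI impI)
  show "inv_into U \<phi> ` topspace (top_of_set (\<phi> ` U)) \<subseteq> topspace (atlas_topology A)"
    using chart_inv[OF assms] chart_subset_points[OF assms] by auto
next
  fix W assume W: "openin (atlas_topology A) W"
  have "{x \<in> topspace (top_of_set (\<phi> ` U)). inv_into U \<phi> x \<in> W} = \<phi> ` (W \<inter> U)"
    using chart_inv[OF assms] by force
  then show "openin (top_of_set (\<phi> ` U)) {x \<in> topspace (top_of_set (\<phi> ` U)). inv_into U \<phi> x \<in> W}"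
    using openin_image_chart[OF W assms] by (auto intro: open_subset)
qed

text \<open>The two coordinate expressions differ by a transition map, which is smooth.\<close>

lemma smooth_on_change_chart:
  fixes f :: "'m \<Rightarrow> 'b::real_normed_vector"
  assumes U: "(U, \<phi>) \<in> A" and V: "(V, \<psi>) \<in> A" and W: "openin (atlas_topology A) W" "W \<subseteq> U"
    and f: "smooth_on (\<phi> ` W) (f \<circ> inv_into U \<phi>)"
  shows "smooth_on (\<psi> ` (W \<inter> V)) (f \<circ> inv_into V \<psi>)"
proof (rule smooth_on_cong)
  show op: "open (\<psi> ` (W \<inter> V))" using openin_image_chart[OF W(1) V] .
  show "smooth_on (\<psi> ` (W \<inter> V)) (\<lambda>y. (f \<circ> inv_into U \<phi>) ((\<phi> \<circ> inv_into V \<psi>) y))"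
    by (rule smooth_on_compose[OF op _ smooth_on_subset[OF smooth_transition[OF V U]] f])
      (use W chart_inv[OF V] in auto)
  show "(f \<circ> inv_into U \<phi>) ((\<phi> \<circ> inv_into V \<psi>) y) = (f \<circ> inv_into V \<psi>) y" if "y \<in> \<psi> ` (W \<inter> V)" for y
    using that W chart_inv[OF V] chart_inv[OF U] by auto
qed

lemma smooth_near_iff:
  assumes U: "(U, \<phi>) \<in> A" and p: "p \<in> U"
  shows "smooth_near A p f \<longleftrightarrow>
    (\<exists>S. open S \<and> \<phi> p \<in> S \<and> S \<subseteq> \<phi> ` U \<and> smooth_on S (f \<circ> inv_into U \<phi>))"
proof
  assume "smooth_near A p f"
  then obtain W where "p \<in> W" "openin (atlas_topology A) W" "smooth_on (\<phi> ` (W \<inter> U)) (f \<circ> inv_into U \<phi>)"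
    unfolding smooth_near_def smooth_fun_on_def using U by auto
  then show "\<exists>S. open S \<and> \<phi> p \<in> S \<and> S \<subseteq> \<phi> ` U \<and> smooth_on S (f \<circ> inv_into U \<phi>)"
    using openin_image_chart[OF _ U] p by (intro exI[of _ "\<phi> ` (W \<inter> U)"]) auto
next
  assume "\<exists>S. open S \<and> \<phi> p \<in> S \<and> S \<subseteq> \<phi> ` U \<and> smooth_on S (f \<circ> inv_into U \<phi>)"
  then obtain S where S: "open S" "\<phi> p \<in> S" "S \<subseteq> \<phi> ` U" "smooth_on S (f \<circ> inv_into U \<phi>)" by blast
  let ?W = "{q \<in> U. \<phi> q \<in> S}"
  have W: "openin (atlas_topology A) ?W" using openin_chart_preimage[OF U S(1)] .
  have "smooth_on (\<phi> ` ?W) (f \<circ> inv_into U \<phi>)" using S(4) by (rule smooth_on_subset) auto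
  then have "smooth_on (\<psi> ` (?W \<inter> V)) (f \<circ> inv_into V \<psi>)" if "(V, \<psi>) \<in> A" for V \<psi>
    using smooth_on_change_chart[OF U that W] by auto
  then show "smooth_near A p f" unfolding smooth_near_def smooth_fun_on_def
    using W S(2) p by (intro exI[of _ ?W]) auto
qed

lemma smooth_near_chartI:
  "(U, \<phi>) \<in> A \<Longrightarrow> p \<in> U \<Longrightarrow> smooth_on (\<phi> ` U) (f \<circ> inv_into U \<phi>) \<Longrightarrow> smooth_near A p f"
  by (subst smooth_near_iff) (auto intro: chart_open_image)

lemma smooth_near_has_derivative:
  assumes "(U, \<phi>) \<in> A" "p \<in> U" "smooth_near A p f"
  shows "(f \<circ> inv_into U \<phi> has_derivative frechet_derivative (f \<circ> inv_into U \<phi>) (at (\<phi> p))) (at (\<phi> p))"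
  using assms smooth_near_iff smooth_on_has_derivative by blast


section \<open>Tangent vectors in coordinates\<close>

lemma coord_vec_eqI:
  assumes "(U, \<phi>) \<in> A" "p \<in> U" "smooth_near A p f" "(f \<circ> inv_into U \<phi> has_derivative f') (at (\<phi> p))"
  shows "coord_vec A (U, \<phi>) p a f = f' a"
  using assms frechet_derivative_at[OF assms(4)] by (simp add: coord_vec_def)

lemma coord_vec_add:
  assumes "(U, \<phi>) \<in> A" "p \<in> U"
  shows "coord_vec A (U, \<phi>) p (a + b) = tv_add (coord_vec A (U, \<phi>) p a) (coord_vec A (U, \<phi>) p b)"
  using linear_add[OF has_derivative_linear[OF smooth_near_has_derivative[OF assms]]]
  by (auto simp: coord_vec_def tv_add_def)

lemma coord_vec_scale:
  assumes "(U, \<phi>) \<in> A" "p \<in> U"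
  shows "coord_vec A (U, \<phi>) p (r *\<^sub>R a) = tv_scale r (coord_vec A (U, \<phi>) p a)"
  using linear_cmul[OF has_derivative_linear[OF smooth_near_has_derivative[OF assms]]]
  by (auto simp: coord_vec_def tv_scale_def)

text \<open>Tangent vectors detect their coefficients because the coordinate functions are smooth near the
  point, hence among the functions on which tangent vectors act by differentiation.\<close>

lemma components_coord_vec:
  assumes U: "(U, \<phi>) \<in> A" "p \<in> U"
  shows "components \<phi> (coord_vec A (U, \<phi>) p a) = a"
proof -
  have "coord_vec A (U, \<phi>) p a (\<lambda>q. \<phi> q \<bullet> b) = a \<bullet> b" for b
  proof (rule coord_vec_eqI[OF U])
    have e: "x \<bullet> b = ((\<lambda>q. \<phi> q \<bullet> b) \<circ> inv_into U \<phi>) x" if "x \<in> \<phi> ` U" for x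
      using that chart_inv[OF U(1)] by auto
    show "smooth_near A p (\<lambda>q. \<phi> q \<bullet> b)"
      by (rule smooth_near_chartI[OF U smooth_on_cong[OF chart_open_image[OF U(1)] e]])
        (auto intro!: smooth_on_inner smooth_on_ident smooth_on_const chart_open_image[OF U(1)])
    show "((\<lambda>q. \<phi> q \<bullet> b) \<circ> inv_into U \<phi> has_derivative (\<lambda>x. x \<bullet> b)) (at (\<phi> p))"
      by (rule has_derivative_transform_within_open[OF _ chart_open_image[OF U(1)] _ e])
        (use U in \<open>auto intro!: derivative_eq_intros\<close>)
  qed
  then show ?thesis unfolding components_def by (simp add: euclidean_representation)
qed

end

text \<open>Both sides are the directional derivative of \<open>f \<circ> F\<close>, computed once directly and once by the
  chain rule. A function that is not smooth near the image point is sent to \<open>0\<close> by both.\<close>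

lemma pushforward_coord_vec:
  assumes "atlas A" "atlas B" and U: "(U, \<phi>) \<in> A" "p \<in> U" and V: "(V, \<psi>) \<in> B"
    and S: "open S" "\<phi> p \<in> S" "S \<subseteq> \<phi> ` U" and F: "\<And>x. x \<in> S \<Longrightarrow> F (inv_into U \<phi> x) \<in> V"
    and T: "smooth_on S T" "\<And>x. x \<in> S \<Longrightarrow> T x = \<psi> (F (inv_into U \<phi> x))"
    and T': "(T has_derivative T') (at (\<phi> p))"
  shows "pushforward B F p (coord_vec A (U, \<phi>) p a) = coord_vec B (V, \<psi>) (F p) (T' a)"
proof
  interpret A: atlas A by fact
  interpret B: atlas B by fact
  fix f
  have Fp: "F p \<in> V" "T (\<phi> p) = \<psi> (F p)" using F[OF S(2)] T(2)[OF S(2)] A.chart_inv[OF U] by auto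
  show "pushforward B F p (coord_vec A (U, \<phi>) p a) f = coord_vec B (V, \<psi>) (F p) (T' a) f"
  proof (cases "smooth_near B (F p) f")
    case False
    then show ?thesis by (simp add: pushforward_def coord_vec_def)
  next
    case True
    let ?f = "f \<circ> inv_into V \<psi>"
    obtain S' where S': "open S'" "\<psi> (F p) \<in> S'" "smooth_on S' ?f"
      using True B.smooth_near_iff[OF V Fp(1)] by auto
    define S2 where "S2 = S \<inter> T -` S'"
    have S2: "open S2" "\<phi> p \<in> S2" "S2 \<subseteq> S"
      using smooth_on_continuous[OF T(1)] S S'(1,2) Fp
      by (auto simp: S2_def continuous_on_open_vimage Int_commute)
    have e: "?f (T x) = (f \<circ> F \<circ> inv_into U \<phi>) x" if "x \<in> S2" for x
      using that F T(2) B.chart_inv[OF V] by (auto simp: S2_def)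
    have sm: "smooth_near A p (f \<circ> F)"
      unfolding A.smooth_near_iff[OF U]
    proof (intro exI[of _ S2] conjI)
      show "smooth_on S2 (f \<circ> F \<circ> inv_into U \<phi>)"
        by (rule smooth_on_cong[OF S2(1) e smooth_on_compose[OF S2(1) _ smooth_on_subset[OF T(1)] S'(3)]])
          (auto simp: S2_def)
    qed (use S2 S in auto)
    have "(?f has_derivative frechet_derivative ?f (at (\<psi> (F p)))) (at (T (\<phi> p)))"
      using B.smooth_near_has_derivative[OF V Fp(1) True] Fp by simp
    then have "((\<lambda>x. ?f (T x)) has_derivative (\<lambda>a. frechet_derivative ?f (at (\<psi> (F p))) (T' a))) (at (\<phi> p))"
      by (rule has_derivative_compose[OF T'])
    then have "(f \<circ> F \<circ> inv_into U \<phi> has_derivative (\<lambda>a. frechet_derivative ?f (at (\<psi> (F p))) (T' a))) (at (\<phi> p))"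
      by (rule has_derivative_transform_within_open[OF _ S2(1,2) e])
    then have "coord_vec A (U, \<phi>) p a (f \<circ> F) = frechet_derivative ?f (at (\<psi> (F p))) (T' a)"
      by (rule A.coord_vec_eqI[OF U sm])
    then show ?thesis using True by (simp add: pushforward_def coord_vec_def)
  qed
qed

context atlas begin

text \<open>The change of coordinates is the chain rule for the identity map, read in two charts.\<close>

lemma coord_vec_change_chart:
  assumes U: "(U, \<phi>) \<in> A" and V: "(V, \<psi>) \<in> A" and p: "p \<in> U" "p \<in> V"
  shows "coord_vec A (U, \<phi>) p a =
    coord_vec A (V, \<psi>) p (frechet_derivative (\<psi> \<circ> inv_into U \<phi>) (at (\<phi> p)) a)"
proof -
  have "pushforward A (\<lambda>q. q) p (coord_vec A (U, \<phi>) p a) =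
    coord_vec A (V, \<psi>) p (frechet_derivative (\<psi> \<circ> inv_into U \<phi>) (at (\<phi> p)) a)"
    by (rule pushforward_coord_vec[OF atlas_axioms atlas_axioms U p(1) V open_overlap[OF U V] _ _ _
          smooth_transition[OF U V] _ smooth_on_has_derivative[OF smooth_transition[OF U V]]])
      (use p chart_inv[OF U] in auto)
  moreover have "pushforward A (\<lambda>q. q) p (coord_vec A (U, \<phi>) p a) = coord_vec A (U, \<phi>) p a"
    by (auto simp: pushforward_def coord_vec_def comp_def)
  ultimately show ?thesis by simp
qed

lemma tangent_space_chart:
  assumes "(U, \<phi>) \<in> A" "p \<in> U"
  shows "tangent_space A p = range (coord_vec A (U, \<phi>) p)"
proof
  show "tangent_space A p \<subseteq> range (coord_vec A (U, \<phi>) p)"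
    using coord_vec_change_chart[OF _ assms(1) _ assms(2)] unfolding tangent_space_def by fastforce
  show "range (coord_vec A (U, \<phi>) p) \<subseteq> tangent_space A p"
    using assms unfolding tangent_space_def by force
qed

lemma coord_vec_in_tangent_space:
  "(U, \<phi>) \<in> A \<Longrightarrow> p \<in> U \<Longrightarrow> coord_vec A (U, \<phi>) p a \<in> tangent_space A p"
  by (simp add: tangent_space_chart)

lemma coord_vec_components:
  "(U, \<phi>) \<in> A \<Longrightarrow> p \<in> U \<Longrightarrow> v \<in> tangent_space A p \<Longrightarrow> coord_vec A (U, \<phi>) p (components \<phi> v) = v"
  by (auto simp: tangent_space_chart components_coord_vec)

lemma tangent_vec_eqI:
  "(U, \<phi>) \<in> A \<Longrightarrow> p \<in> U \<Longrightarrow> v \<in> tangent_space A p \<Longrightarrow> w \<in> tangent_space A p \<Longrightarrow>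
    components \<phi> v = components \<phi> w \<Longrightarrow> v = w"
  using coord_vec_components by metis

lemma tangent_space_add:
  assumes "p \<in> points A" "u \<in> tangent_space A p" "v \<in> tangent_space A p"
  shows "tv_add u v \<in> tangent_space A p"
proof -
  obtain U \<phi> where U: "(U, \<phi>) \<in> A" "p \<in> U" using points_chart[OF assms(1)] .
  show ?thesis using assms(2,3) unfolding tangent_space_chart[OF U] 
    by (auto simp flip: coord_vec_add[OF U])
qed

lemma tangent_space_scale:
  assumes "p \<in> points A" "u \<in> tangent_space A p"
  shows "tv_scale r u \<in> tangent_space A p"
proof -
  obtain U \<phi> where U: "(U, \<phi>) \<in> A" "p \<in> U" using points_chart[OF assms(1)] .
  show ?thesis using assms(2) unfolding tangent_space_chart[OF U] 
    by (auto simp flip: coord_vec_scale[OF U])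
qed

end

lemma components_add: "components \<phi> (tv_add u v) = components \<phi> u + components \<phi> v"
  by (simp add: components_def tv_add_def scaleR_add_left sum.distrib)

lemma components_scale: "components \<phi> (tv_scale r u) = r *\<^sub>R components \<phi> u"
  by (simp add: components_def tv_scale_def scaleR_sum_right)

section \<open>The tangent bundle is a manifold\<close>

context atlas begin

text \<open>An atlas may be uncountable, but countably many charts cover the manifold: every member of a
  countable base that fits into a chart domain selects one such chart. Conversely, countably many
  charts pull back a countable base of the model space to a base of the manifold. In this form second
  countability passes to the tangent bundle.\<close>

lemma second_countable_atlas_iff:
  "second_countable (atlas_topology A) \<longleftrightarrow> (\<exists>C\<subseteq>A. countable C \<and> points A \<subseteq> \<Union> (fst ` C))"
proof
  assume "second_countable (atlas_topology A)"
  then obtain \<B> where \<B>: "countable \<B>"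
    "\<And>W p. openin (atlas_topology A) W \<Longrightarrow> p \<in> W \<Longrightarrow> \<exists>B\<in>\<B>. p \<in> B \<and> B \<subseteq> W"
    unfolding second_countable_def by metis
  let ?\<B> = "{B \<in> \<B>. \<exists>c\<in>A. B \<subseteq> fst c}"
  define ch where "ch B = (SOME c. c \<in> A \<and> B \<subseteq> fst c)" for B
  have "ch B \<in> A \<and> B \<subseteq> fst (ch B)" if "B \<in> ?\<B>" for B
    unfolding ch_def by (rule someI_ex) (use that in blast)
  then have ch: "ch B \<in> A" "B \<subseteq> fst (ch B)" if "B \<in> ?\<B>" for B
    using that by blast+
  have "p \<in> \<Union> (fst ` ch ` ?\<B>)" if p: "p \<in> points A" for p
  proof -
    obtain U \<phi> where U: "(U, \<phi>) \<in> A" "p \<in> U" using points_chart[OF p] .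
    then obtain B where "B \<in> \<B>" "p \<in> B" "B \<subseteq> U" using \<B>(2)[OF openin_chart[OF U(1)] U(2)] by blast
    then have "B \<in> ?\<B>" using U by force
    then show ?thesis using ch \<open>p \<in> B\<close> by blast
  qed
  then have "points A \<subseteq> \<Union> (fst ` ch ` ?\<B>)" by (rule subsetI)
  moreover have "ch ` ?\<B> \<subseteq> A" by (rule image_subsetI) (rule ch(1))
  moreover have "countable (ch ` ?\<B>)" using \<B>(1) by simp
  ultimately show "\<exists>C\<subseteq>A. countable C \<and> points A \<subseteq> \<Union> (fst ` C)" by (intro exI[of _ "ch ` ?\<B>"]) simp
next
  assume "\<exists>C\<subseteq>A. countable C \<and> points A \<subseteq> \<Union> (fst ` C)"
  then obtain C where C: "C \<subseteq> A" "countable C" "points A \<subseteq> \<Union> (fst ` C)" by blast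
  obtain \<B> :: "'e set set" where \<B>: "countable \<B>" "topological_basis \<B>"
    using ex_countable_basis by blast
  define pre :: "('m, 'e) chart \<times> 'e set \<Rightarrow> 'm set"
    where "pre = (\<lambda>((U, \<phi>), B). {p \<in> U. \<phi> p \<in> B})"
  show "second_countable (atlas_topology A)"
    unfolding second_countable_def
  proof (intro exI[of _ "pre ` (C \<times> \<B>)"] conjI ballI allI impI)
    show "countable (pre ` (C \<times> \<B>))" using C(2) \<B>(1) by auto
    show "openin (atlas_topology A) V" if V: "V \<in> pre ` (C \<times> \<B>)" for V
    proof -
      obtain U \<phi> B where *: "V = pre ((U, \<phi>), B)" "(U, \<phi>) \<in> C" "B \<in> \<B>" using V by auto
      show ?thesis
        using openin_chart_preimage[OF subsetD[OF C(1) *(2)] topological_basis_open[OF \<B>(2) *(3)]]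
        by (simp add: pre_def *(1))
    qed
    fix W p assume W: "openin (atlas_topology A) W \<and> p \<in> W"
    then have "p \<in> points A" using openin_atlas_iff by auto
    then have "p \<in> \<Union> (fst ` C)" using C(3) by blast
    then obtain U \<phi> where U: "(U, \<phi>) \<in> C" "p \<in> U" by auto
    have "(U, \<phi>) \<in> A" using U C(1) by auto
    obtain B where B: "B \<in> \<B>" "\<phi> p \<in> B" "B \<subseteq> \<phi> ` (W \<inter> U)"
      using topological_basisE[OF \<B>(2) openin_image_chart[OF _ \<open>(U, \<phi>) \<in> A\<close>], of W "\<phi> p"] W U(2) by blast
    have "{q \<in> U. \<phi> q \<in> B} \<subseteq> W"
      using B(3) chart_inj[OF \<open>(U, \<phi>) \<in> A\<close>] by (auto simp: inj_on_def)
    moreover have "{q \<in> U. \<phi> q \<in> B} \<in> pre ` (C \<times> \<B>)"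
      using U(1) B(1) by (intro image_eqI[of _ _ "((U, \<phi>), B)"]) (auto simp: pre_def)
    ultimately show "\<exists>V\<in>pre ` (C \<times> \<B>). p \<in> V \<and> V \<subseteq> W"
      using U(2) B(2) by blast
  qed
qed

abbreviation tdom :: "'m set \<Rightarrow> ('m \<times> 'm tvec) set" where
  "tdom U \<equiv> Sigma U (tangent_space A)"

abbreviation tmap :: "('m \<Rightarrow> 'e) \<Rightarrow> 'm \<times> 'm tvec \<Rightarrow> 'e \<times> 'e" where
  "tmap \<phi> \<equiv> \<lambda>(p, v). (\<phi> p, components \<phi> v)"

lemma tangent_chartI: "(U, \<phi>) \<in> A \<Longrightarrow> (tdom U, tmap \<phi>) \<in> tangent_bundle A"
  unfolding tangent_bundle_def tangent_chart_def by (force simp: image_iff)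

lemma tangent_chartE:
  assumes "(U', \<Phi>) \<in> tangent_bundle A"
  obtains U \<phi> where "(U, \<phi>) \<in> A" "U' = tdom U" "\<Phi> = tmap \<phi>"
  using assms unfolding tangent_bundle_def tangent_chart_def by auto

lemma points_tangent_bundle: "points (tangent_bundle A) = Sigma (points A) (tangent_space A)"
  unfolding points_def tangent_bundle_def tangent_chart_def by force

lemma tmap_image:
  assumes U: "(U, \<phi>) \<in> A" "W \<subseteq> U"
  shows "tmap \<phi> ` tdom W = \<phi> ` W \<times> UNIV"
proof -
  have "(\<phi> p, a) \<in> tmap \<phi> ` tdom W" if "p \<in> W" for p a
    using that U components_coord_vec[OF U(1)] coord_vec_in_tangent_space[OF U(1)]
    by (intro image_eqI[of _ _ "(p, coord_vec A (U, \<phi>) p a)"]) auto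
  then show ?thesis by auto
qed

lemma tmap_inj:
  assumes U: "(U, \<phi>) \<in> A"
  shows "inj_on (tmap \<phi>) (tdom U)"
  using chart_inj[OF U] tangent_vec_eqI[OF U] unfolding inj_on_def by (auto 4 4)

lemma tmap_inv:
  assumes U: "(U, \<phi>) \<in> A" and x: "x \<in> \<phi> ` U"
  shows "inv_into (tdom U) (tmap \<phi>) (x, a) = (inv_into U \<phi> x, coord_vec A (U, \<phi>) (inv_into U \<phi> x) a)"
proof (rule inv_into_f_eq[OF tmap_inj[OF U]])
  have "inv_into U \<phi> x \<in> U" "\<phi> (inv_into U \<phi> x) = x"
    using inv_into_into[OF x] f_inv_into_f[OF x] by auto
  then show "(inv_into U \<phi> x, coord_vec A (U, \<phi>) (inv_into U \<phi> x) a) \<in> tdom U"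
    "tmap \<phi> (inv_into U \<phi> x, coord_vec A (U, \<phi>) (inv_into U \<phi> x) a) = (x, a)"
    using U by (auto simp: coord_vec_in_tangent_space components_coord_vec)
qed

text \<open>The transition maps of the tangent bundle are \<open>(x, a) \<mapsto> (\<tau> x, D\<tau>\<^sub>x a)\<close>, where \<open>\<tau>\<close> is the
  transition map of the base.\<close>

lemma atlas_tangent_bundle: "atlas (tangent_bundle A)"
proof -
  have "inj_on \<Phi> U' \<and> open (\<Phi> ` U')" if "(U', \<Phi>) \<in> tangent_bundle A" for U' \<Phi>
    using that by (auto elim!: tangent_chartE simp: tmap_inj tmap_image intro!: open_Times chart_open_image)
  moreover have "open (\<Phi> ` (U' \<inter> V')) \<and> smooth_on (\<Phi> ` (U' \<inter> V')) (\<Psi> \<circ> inv_into U' \<Phi>)"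
    if UV: "(U', \<Phi>) \<in> tangent_bundle A" "(V', \<Psi>) \<in> tangent_bundle A" for U' \<Phi> V' \<Psi>
  proof -
    obtain U \<phi> where U: "(U, \<phi>) \<in> A" "U' = tdom U" "\<Phi> = tmap \<phi>" using UV(1) by (rule tangent_chartE)
    obtain V \<psi> where V: "(V, \<psi>) \<in> A" "V' = tdom V" "\<Psi> = tmap \<psi>" using UV(2) by (rule tangent_chartE)
    let ?D = "\<phi> ` (U \<inter> V) \<times> (UNIV :: 'e set)"
    let ?\<tau> = "\<psi> \<circ> inv_into U \<phi>"
    have "U' \<inter> V' = tdom (U \<inter> V)" using U V by auto
    then have im: "\<Phi> ` (U' \<inter> V') = ?D" using tmap_image[OF U(1), of "U \<inter> V"] U(3) by auto
    have op: "open ?D" using open_overlap[OF U(1) V(1)] by (simp add: open_Times)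
    have \<tau>: "smooth_on (\<phi> ` (U \<inter> V)) ?\<tau>" using smooth_transition[OF U(1) V(1)] .
    have fst_sm: "smooth_on ?D (\<lambda>z. h (fst z))" if "smooth_on (\<phi> ` (U \<inter> V)) h" for h :: "'e \<Rightarrow> 'e"
      by (rule smooth_on_compose[OF op _ smooth_on_fst[OF op smooth_on_ident[OF op]] that]) auto
    have "smooth_on ?D (\<lambda>z. (?\<tau> (fst z), frechet_derivative ?\<tau> (at (fst z)) (snd z)))"
    proof (rule smooth_on_Pair[OF op fst_sm[OF \<tau>] smooth_on_linear_family[OF op,
            where L = "\<lambda>z. frechet_derivative ?\<tau> (at (fst z))" and w = snd]])
      show "linear (frechet_derivative ?\<tau> (at (fst z)))" if "z \<in> ?D" for z
        using has_derivative_linear[OF smooth_on_has_derivative[OF \<tau>]] that by auto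
      show "smooth_on ?D (\<lambda>z. frechet_derivative ?\<tau> (at (fst z)) b)" for b
        by (rule fst_sm[OF smooth_on_derivative[OF \<tau>]])
      show "smooth_on ?D snd" using smooth_on_snd[OF op smooth_on_ident[OF op]] .
    qed
    then have "smooth_on ?D (\<Psi> \<circ> inv_into U' \<Phi>)"
    proof (rule smooth_on_cong[OF op, rotated])
      fix z assume "z \<in> ?D"
      then obtain p a where z: "z = (\<phi> p, a)" "p \<in> U" "p \<in> V" by auto
      then show "(?\<tau> (fst z), frechet_derivative ?\<tau> (at (fst z)) (snd z)) = (\<Psi> \<circ> inv_into U' \<Phi>) z"
        unfolding U V
        by (simp add: tmap_inv[OF U(1)] chart_inv[OF U(1)]
            coord_vec_change_chart[OF U(1) V(1)] components_coord_vec[OF V(1)])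
    qed
    then show ?thesis using im op by simp
  qed
  ultimately show ?thesis unfolding atlas_def smooth_atlas_def by blast
qed

lemma openin_tangent_bundle_preimage:
  assumes "openin (atlas_topology A) W"
  shows "openin (atlas_topology (tangent_bundle A)) (tdom W)"
proof -
  have "open (\<Phi> ` (tdom W \<inter> U'))" if U': "(U', \<Phi>) \<in> tangent_bundle A" for U' \<Phi>
  proof -
    obtain U \<phi> where U: "(U, \<phi>) \<in> A" "U' = tdom U" "\<Phi> = tmap \<phi>" using U' by (rule tangent_chartE)
    have "tdom W \<inter> U' = tdom (W \<inter> U)" using U by auto
    then show ?thesis
      using tmap_image[OF U(1), of "W \<inter> U"] openin_image_chart[OF assms U(1)] U(3) by (simp add: open_Times)
  qed
  moreover have "tdom W \<subseteq> points (tangent_bundle A)"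
    using assms unfolding points_tangent_bundle openin_atlas_iff by auto
  ultimately show ?thesis unfolding atlas.openin_atlas_iff[OF atlas_tangent_bundle] by auto
qed

text \<open>Vectors at distinct points are separated by open sets of the base, vectors at the same point
  inside a single chart.\<close>

lemma Hausdorff_tangent_bundle:
  assumes "Hausdorff_space (atlas_topology A)"
  shows "Hausdorff_space (atlas_topology (tangent_bundle A))"
proof -
  interpret TM: atlas "tangent_bundle A" by (rule atlas_tangent_bundle)
  have "\<exists>W1 W2. openin (atlas_topology (tangent_bundle A)) W1 \<and>
      openin (atlas_topology (tangent_bundle A)) W2 \<and> (p, v) \<in> W1 \<and> (q, w) \<in> W2 \<and> disjnt W1 W2"
    if v: "p \<in> points A" "v \<in> tangent_space A p" and w: "q \<in> points A" "w \<in> tangent_space A q"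
      and ne: "(p, v) \<noteq> (q, w)" for p v q w
  proof (cases "p = q")
    case False
    then obtain W1 W2 where W: "openin (atlas_topology A) W1" "openin (atlas_topology A) W2"
      "p \<in> W1" "q \<in> W2" "disjnt W1 W2"
      using assms v w unfolding Hausdorff_space_def by (metis topspace_atlas)
    then have "disjnt (tdom W1) (tdom W2)" by (auto simp: disjnt_def)
    then show ?thesis using W v w openin_tangent_bundle_preimage
      by (intro exI[of _ "tdom W1"] exI[of _ "tdom W2"]) auto
  next
    case True
    obtain U \<phi> where U: "(U, \<phi>) \<in> A" "p \<in> U" using points_chart[OF v(1)] .
    have "tmap \<phi> (p, v) \<noteq> tmap \<phi> (q, w)"
      using tmap_inj[OF U(1)] U v w ne True unfolding inj_on_def by blast
    then obtain S1 S2 where "open S1" "open S2" "tmap \<phi> (p, v) \<in> S1" "tmap \<phi> (q, w) \<in> S2" "S1 \<inter> S2 = {}"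
      using separation_t2 by meson
    then show ?thesis
      using TM.openin_chart_preimage[OF tangent_chartI[OF U(1)]] U v w True
      by (intro exI[of _ "{t \<in> tdom U. tmap \<phi> t \<in> S1}"] exI[of _ "{t \<in> tdom U. tmap \<phi> t \<in> S2}"])
        (auto simp: disjnt_def)
  qed
  then show ?thesis unfolding Hausdorff_space_def TM.topspace_atlas points_tangent_bundle by blast
qed

lemma smooth_manifold_tangent_bundle:
  assumes "smooth_manifold A"
  shows "smooth_manifold (tangent_bundle A)"
proof -
  have "second_countable (atlas_topology A)" using assms by (simp add: smooth_manifold_def)
  then obtain C where C: "C \<subseteq> A" "countable C" "points A \<subseteq> \<Union> (fst ` C)"
    unfolding second_countable_atlas_iff by blast
  have "points (tangent_bundle A) \<subseteq> \<Union> (fst ` tangent_chart A ` C)"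
    using C(3) unfolding points_tangent_bundle by (fastforce simp: tangent_chart_def)
  moreover have "tangent_chart A ` C \<subseteq> tangent_bundle A" "countable (tangent_chart A ` C)"
    using C unfolding tangent_bundle_def by auto
  ultimately have "second_countable (atlas_topology (tangent_bundle A))"
    unfolding atlas.second_countable_atlas_iff[OF atlas_tangent_bundle] by blast
  then show ?thesis
    using assms Hausdorff_tangent_bundle atlas_tangent_bundle by (simp add: smooth_manifold_def atlas_def)
qed

end

context atlas begin

text \<open>In coordinates \<open>\<pi>\<close> is the projection \<open>(x, u) \<mapsto> x\<close>, and a section \<open>Z\<close> is the graph
  \<open>x \<mapsto> (x, \<zeta> x)\<close> of its components.\<close>

lemma pushforward_fst:
  assumes U: "(U, \<phi>) \<in> A" "p \<in> U" and v: "v \<in> tangent_space A p"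
  shows "pushforward A fst (p, v) (coord_vec (tangent_bundle A) (tdom U, tmap \<phi>) (p, v) (a, b)) =
    coord_vec A (U, \<phi>) p a"
proof -
  have op: "open (\<phi> ` U \<times> (UNIV :: 'e set))" using chart_open_image[OF U(1)] by (simp add: open_Times)
  have im: "tmap \<phi> ` tdom U = \<phi> ` U \<times> UNIV" using tmap_image[OF U(1)] by simp
  have "pushforward A fst (p, v) (coord_vec (tangent_bundle A) (tdom U, tmap \<phi>) (p, v) (a, b)) =
    coord_vec A (U, \<phi>) (fst (p, v)) (fst (a, b))"
  proof (rule pushforward_coord_vec[OF atlas_tangent_bundle atlas_axioms tangent_chartI[OF U(1)] _ U(1) op,
        where T = fst])
    show "smooth_on (\<phi> ` U \<times> (UNIV :: 'e set)) (fst :: 'e \<times> 'e \<Rightarrow> 'e)"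
      using smooth_on_fst[OF op smooth_on_ident[OF op]] .
    show "(fst has_derivative (fst :: 'e \<times> 'e \<Rightarrow> 'e)) (at (tmap \<phi> (p, v)))"
      by (rule bounded_linear_imp_has_derivative[OF bounded_linear_fst])
  qed (use U v im in \<open>auto simp: tmap_inv[OF U(1)] chart_inv[OF U(1)]\<close>)
  then show ?thesis by simp
qed

lemma pushforward_section:
  assumes U: "(U, \<phi>) \<in> A" "p \<in> U" and N: "openin (atlas_topology A) N" "p \<in> N" "N \<subseteq> U"
    and Z: "\<And>q. q \<in> N \<Longrightarrow> Z q \<in> tangent_space A q"
    and \<zeta>: "smooth_on (\<phi> ` N) \<zeta>" "\<And>q. q \<in> N \<Longrightarrow> \<zeta> (\<phi> q) = components \<phi> (Z q)"
    and \<zeta>': "(\<zeta> has_derivative \<zeta>') (at (\<phi> p))"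
  shows "pushforward (tangent_bundle A) (\<lambda>q. (q, Z q)) p (coord_vec A (U, \<phi>) p a) =
    coord_vec (tangent_bundle A) (tdom U, tmap \<phi>) (p, Z p) (a, \<zeta>' a)"
proof -
  have op: "open (\<phi> ` N)" using openin_image_chart[OF N(1) U(1)] N(3) by (simp add: Int_absorb2)
  show ?thesis
  proof (rule pushforward_coord_vec[OF atlas_axioms atlas_tangent_bundle U tangent_chartI[OF U(1)] op,
        where T = "\<lambda>x. (x, \<zeta> x)"])
    show "smooth_on (\<phi> ` N) (\<lambda>x. (x, \<zeta> x))"
      by (intro smooth_on_Pair smooth_on_ident op \<zeta>)
    show "((\<lambda>x. (x, \<zeta> x)) has_derivative (\<lambda>a. (a, \<zeta>' a))) (at (\<phi> p))"
      by (intro has_derivative_Pair has_derivative_ident \<zeta>')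
  qed (use N Z \<zeta>(2) chart_inv[OF U(1)] in \<open>auto simp: subset_iff\<close>)
qed


section \<open>Extending local data to global vector fields\<close>

lemma smooth_zero_extension:
  fixes F :: "'m \<Rightarrow> 'b::real_normed_vector"
  assumes V: "(V, \<psi>) \<in> A" and U: "openin (atlas_topology A) U"
    and C: "closedin (atlas_topology A) C" "C \<subseteq> U"
    and F: "smooth_on (\<psi> ` (U \<inter> V)) (F \<circ> inv_into V \<psi>)" "\<And>q. q \<in> V \<Longrightarrow> q \<notin> C \<Longrightarrow> F q = 0"
  shows "smooth_on (\<psi> ` V) (F \<circ> inv_into V \<psi>)"
proof (rule smooth_on_local)
  fix x assume "x \<in> \<psi> ` V"
  then obtain q where q: "q \<in> V" "x = \<psi> q" by blast
  show "\<exists>T. open T \<and> x \<in> T \<and> smooth_on T (F \<circ> inv_into V \<psi>)"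
  proof (cases "q \<in> U")
    case True
    then show ?thesis using openin_image_chart[OF U V] F(1) q by blast
  next
    case False
    let ?W = "points A - C"
    have W: "openin (atlas_topology A) ?W" using C(1) by (metis openin_diff openin_topspace topspace_atlas)
    have "open (\<psi> ` (?W \<inter> V))" using openin_image_chart[OF W V] .
    moreover have "smooth_on (\<psi> ` (?W \<inter> V)) (F \<circ> inv_into V \<psi>)"
      by (rule smooth_on_cong[OF \<open>open _\<close> _ smooth_on_const[of _ 0]]) (use F(2) chart_inv[OF V] in auto)
    moreover have "x \<in> \<psi> ` (?W \<inter> V)" using q False C(2) chart_subset_points[OF V] by blast
    ultimately show ?thesis by blast
  qed
qed

text \<open>A function that is \<open>1\<close> on \<open>N\<close> and vanishes off a closed subset of the chart domain \<open>U\<close>.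
  Closedness in the whole manifold, not in \<open>U\<close>, is what makes the extension by \<open>0\<close> smooth.\<close>

definition cutoff :: "'m set \<Rightarrow> ('m \<Rightarrow> 'e) \<Rightarrow> 'm set \<Rightarrow> ('m \<Rightarrow> real) \<Rightarrow> bool" where
  "cutoff U \<phi> N \<beta> \<longleftrightarrow> (U, \<phi>) \<in> A \<and> openin (atlas_topology A) N \<and> N \<subseteq> U \<and>
     (\<forall>q\<in>N. \<beta> q = 1) \<and> smooth_on (\<phi> ` U) (\<beta> \<circ> inv_into U \<phi>) \<and>
     (\<exists>C. closedin (atlas_topology A) C \<and> C \<subseteq> U \<and> (\<forall>q. q \<notin> C \<longrightarrow> \<beta> q = 0))"

text \<open>Compact sets are closed in a Hausdorff space, so a bump function in a chart whose support is
  a closed ball extends by \<open>0\<close>.\<close>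

lemma cutoff_exists:
  assumes "Hausdorff_space (atlas_topology A)" and U: "(U, \<phi>) \<in> A" "p \<in> U"
  obtains N \<beta> where "cutoff U \<phi> N \<beta>" "p \<in> N"
proof -
  obtain s where s: "s > 0" "cball (\<phi> p) s \<subseteq> \<phi> ` U"
    using chart_open_image[OF U(1)] U(2) open_contains_cball by (metis imageI)
  define r where "r = s / 2"
  have r: "r > 0" "cball (\<phi> p) (2 * r) \<subseteq> \<phi> ` U" using s by (auto simp: r_def)
  obtain f :: "'e \<Rightarrow> real" where f: "smooth_on UNIV f" "\<And>x. dist (\<phi> p) x < r \<Longrightarrow> f x = 1"
    "\<And>x. dist (\<phi> p) x \<ge> 2 * r \<Longrightarrow> f x = 0"
    using euclidean_bump[OF r(1), of "\<phi> p"] by blast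
  define \<beta> where "\<beta> q = (if q \<in> U then f (\<phi> q) else 0)" for q
  define N where "N = {q \<in> U. \<phi> q \<in> ball (\<phi> p) r}"
  define C where "C = inv_into U \<phi> ` cball (\<phi> p) (2 * r)"
  have "compactin (top_of_set (\<phi> ` U)) (cball (\<phi> p) (2 * r))"
    using r by (simp add: compactin_subtopology)
  then have "compactin (atlas_topology A) C"
    unfolding C_def using image_compactin continuous_map_chart_inv[OF U(1)] by blast
  then have C: "closedin (atlas_topology A) C" using assms(1) compactin_imp_closedin by blast
  have CU: "C \<subseteq> U" unfolding C_def using r(2) chart_inv[OF U(1)] by auto
  have C0: "\<beta> q = 0" if "q \<notin> C" for q
  proof (cases "q \<in> U")
    case True
    then have "\<phi> q \<notin> cball (\<phi> p) (2 * r)" using that chart_inv[OF U(1)] unfolding C_def by (metis imageI)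
    then show ?thesis using f(3) by (simp add: \<beta>_def)
  qed (simp add: \<beta>_def)
  have "smooth_on (\<phi> ` U) (\<beta> \<circ> inv_into U \<phi>)"
    by (rule smooth_on_cong[OF chart_open_image[OF U(1)] _ smooth_on_subset[OF f(1)]])
      (use chart_inv[OF U(1)] in \<open>auto simp: \<beta>_def\<close>)
  moreover have "openin (atlas_topology A) N"
    unfolding N_def by (rule openin_chart_preimage[OF U(1) open_ball])
  moreover have "\<forall>q\<in>N. \<beta> q = 1" using f(2) by (auto simp: N_def \<beta>_def)
  moreover have "p \<in> N" "N \<subseteq> U" using U(2) r(1) by (auto simp: N_def)
  ultimately show ?thesis using that[of N \<beta>] C CU C0 U(1) unfolding cutoff_def by blast
qed

lemma cutoff_smooth_fun:
  assumes \<beta>: "cutoff U \<phi> N \<beta>" and f: "smooth_on (\<phi> ` U) (f \<circ> inv_into U \<phi>)"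
  shows "smooth_fun A (\<lambda>q. \<beta> q * f q)"
proof -
  obtain C where C: "closedin (atlas_topology A) C" "C \<subseteq> U" "\<And>q. q \<notin> C \<Longrightarrow> \<beta> q = 0"
    and U: "(U, \<phi>) \<in> A" and \<beta>_sm: "smooth_on (\<phi> ` U) (\<beta> \<circ> inv_into U \<phi>)"
    using \<beta> unfolding cutoff_def by blast
  have "smooth_on (\<psi> ` (points A \<inter> V)) ((\<lambda>q. \<beta> q * f q) \<circ> inv_into V \<psi>)" if V: "(V, \<psi>) \<in> A" for V \<psi>
  proof -
    have "smooth_on (\<phi> ` U) ((\<lambda>q. \<beta> q * f q) \<circ> inv_into U \<phi>)"
      using smooth_on_mult[OF chart_open_image[OF U] \<beta>_sm f] by (simp add: comp_def)
    then have "smooth_on (\<psi> ` V) ((\<lambda>q. \<beta> q * f q) \<circ> inv_into V \<psi>)"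
      by (intro smooth_zero_extension[OF V openin_chart[OF U] C(1,2)]
          smooth_on_change_chart[OF U V openin_chart[OF U]]) (auto simp: C(3))
    then show ?thesis using chart_subset_points[OF V] by (simp add: Int_absorb1)
  qed
  then show ?thesis
    unfolding smooth_fun_on_def using openin_topspace[of "atlas_topology A"] by auto
qed

abbreviation cutoff_field :: "'m set \<Rightarrow> ('m \<Rightarrow> 'e) \<Rightarrow> ('m \<Rightarrow> real) \<Rightarrow> 'e \<Rightarrow> 'm \<Rightarrow> 'm tvec" where
  "cutoff_field U \<phi> \<beta> a \<equiv> \<lambda>q. tv_scale (\<beta> q) (coord_vec A (U, \<phi>) q a)"

lemma zero_in_tangent_space:
  assumes "p \<in> points A"
  shows "(\<lambda>f. 0) \<in> tangent_space A p"
proof -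
  obtain U \<phi> where U: "(U, \<phi>) \<in> A" "p \<in> U" using points_chart[OF assms] .
  show ?thesis
    using coord_vec_in_tangent_space[OF U, of "0 *\<^sub>R 0"] unfolding coord_vec_scale[OF U] by (simp add: tv_scale_def)
qed

lemma components_zero: "components \<phi> (\<lambda>f. 0) = 0"
  by (simp add: components_def)

lemma cutoff_vector_field:
  assumes \<beta>: "cutoff U \<phi> N \<beta>"
  shows "vector_field A (cutoff_field U \<phi> \<beta> a)"
proof -
  let ?X = "cutoff_field U \<phi> \<beta> a"
  obtain C where C: "closedin (atlas_topology A) C" "C \<subseteq> U" "\<And>q. q \<notin> C \<Longrightarrow> \<beta> q = 0"
    and U: "(U, \<phi>) \<in> A" and \<beta>_sm: "smooth_on (\<phi> ` U) (\<beta> \<circ> inv_into U \<phi>)"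
    using \<beta> unfolding cutoff_def by blast
  have zero: "?X q = (\<lambda>f. 0)" if "q \<notin> C" for q using C(3)[OF that] by (simp add: tv_scale_def)
  have "?X q \<in> tangent_space A q" if "q \<in> points A" for q
    using that zero_in_tangent_space[OF that] zero C(2) coord_vec_in_tangent_space[OF U] tangent_space_scale
    by (cases "q \<in> C") auto
  moreover have "smooth_on (\<psi> ` V) (\<lambda>x. components \<psi> (?X (inv_into V \<psi> x)))" if V: "(V, \<psi>) \<in> A" for V \<psi>
  proof -
    let ?F = "\<lambda>q. components \<psi> (?X q)" and ?\<tau> = "\<psi> \<circ> inv_into U \<phi>"
    have op: "open (\<phi> ` (U \<inter> V))" using open_overlap[OF U V] .
    have "smooth_on (\<phi> ` (U \<inter> V))
        (\<lambda>x. (\<beta> \<circ> inv_into U \<phi>) x *\<^sub>R frechet_derivative ?\<tau> (at x) a)"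
      by (rule smooth_on_scaleR[OF op smooth_on_subset[OF \<beta>_sm] smooth_on_derivative[OF smooth_transition[OF U V]]])
        auto
    then have "smooth_on (\<phi> ` (U \<inter> V)) (?F \<circ> inv_into U \<phi>)"
      by (rule smooth_on_cong[OF op, rotated])
        (auto simp: components_scale chart_inv[OF U] coord_vec_change_chart[OF U V] components_coord_vec[OF V])
    moreover have "openin (atlas_topology A) (U \<inter> V)" using openin_chart[OF U] openin_chart[OF V] by blast
    ultimately have "smooth_on (\<psi> ` (U \<inter> V \<inter> V)) (?F \<circ> inv_into V \<psi>)"
      by (intro smooth_on_change_chart[OF U V]) auto
    then have "smooth_on (\<psi> ` (U \<inter> V)) (?F \<circ> inv_into V \<psi>)" by (simp add: Int_assoc)
    then have "smooth_on (\<psi> ` V) (?F \<circ> inv_into V \<psi>)"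
      by (rule smooth_zero_extension[OF V openin_chart[OF U] C(1,2)]) (simp add: zero components_zero)
    then show ?thesis by (simp add: comp_def)
  qed
  ultimately show ?thesis unfolding vector_field_def by blast
qed

lemma vector_field_extension:
  assumes "Hausdorff_space (atlas_topology A)" "p \<in> points A" "v \<in> tangent_space A p"
  obtains X where "vector_field A X" "X p = v"
proof -
  obtain U \<phi> where U: "(U, \<phi>) \<in> A" "p \<in> U" using points_chart[OF assms(2)] .
  obtain N \<beta> where \<beta>: "cutoff U \<phi> N \<beta>" "p \<in> N" using cutoff_exists[OF assms(1) U] .
  then have "cutoff_field U \<phi> \<beta> (components \<phi> v) p = v"
    using coord_vec_components[OF U assms(3)] by (simp add: cutoff_def tv_scale_def)
  then show ?thesis using that cutoff_vector_field[OF \<beta>(1)] by blast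
qed

lemma smooth_fun_compose_chart:
  assumes "smooth_fun A f" "(U, \<phi>) \<in> A"
  shows "smooth_on (\<phi> ` U) (f \<circ> inv_into U \<phi>)"
  using assms chart_subset_points[OF assms(2)] unfolding smooth_fun_on_def
  by (auto simp: Int_absorb1)

lemma smooth_fun_const: "smooth_fun A (\<lambda>q. r)"
  unfolding smooth_fun_on_def using openin_topspace[of "atlas_topology A"]
  by (auto simp: comp_def smooth_on_const)

lemma vector_field_smooth:
  "vector_field A X \<Longrightarrow> (U, \<phi>) \<in> A \<Longrightarrow> smooth_on (\<phi> ` U) (\<lambda>x. components \<phi> (X (inv_into U \<phi> x)))"
  unfolding vector_field_def by blast

lemma vector_field_tangent: "vector_field A X \<Longrightarrow> p \<in> points A \<Longrightarrow> X p \<in> tangent_space A p"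
  unfolding vector_field_def by blast

lemma vector_field_add:
  assumes "vector_field A X" "vector_field A Y"
  shows "vector_field A (\<lambda>q. tv_add (X q) (Y q))"
  using assms unfolding vector_field_def
  by (auto simp: components_add intro!: tangent_space_add smooth_on_add chart_open_image)

lemma vector_field_scale:
  assumes "smooth_fun A f" "vector_field A X"
  shows "vector_field A (\<lambda>q. tv_scale (f q) (X q))"
proof -
  have "smooth_on (\<phi> ` U) (\<lambda>x. f (inv_into U \<phi> x) *\<^sub>R components \<phi> (X (inv_into U \<phi> x)))"
    if U: "(U, \<phi>) \<in> A" for U \<phi>
    using smooth_on_scaleR[OF chart_open_image[OF U] smooth_fun_compose_chart[OF assms(1) U]
        vector_field_smooth[OF assms(2) U]] by (simp add: comp_def)
  then show ?thesis
    using assms(2) unfolding vector_field_def by (auto simp: components_scale intro!: tangent_space_scale)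
qed

end

section \<open>The connection map in coordinates\<close>

locale manifold_connection = atlas A for A :: "('m, 'e::euclidean_space) chart set" +
  fixes D :: "('m \<Rightarrow> 'm tvec) \<Rightarrow> ('m \<Rightarrow> 'm tvec) \<Rightarrow> ('m \<Rightarrow> 'm tvec)"
    and K :: "'m \<times> 'm tvec \<Rightarrow> ('m \<times> 'm tvec) tvec \<Rightarrow> 'm tvec"
  assumes Hausdorff: "Hausdorff_space (atlas_topology A)"
    and connection: "affine_connection A D"
    and K: "connection_map A D K"
begin

sublocale TM: atlas "tangent_bundle A"
  by (rule atlas_tangent_bundle)

abbreviation lifted_coord_vec :: "'m set \<Rightarrow> ('m \<Rightarrow> 'e) \<Rightarrow> 'm \<times> 'm tvec \<Rightarrow> 'e \<times> 'e \<Rightarrow> ('m \<times> 'm tvec) tvec" where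
  "lifted_coord_vec U \<phi> t c \<equiv> coord_vec (tangent_bundle A) (tdom U, tmap \<phi>) t c"

lemma K_linear:
  "t \<in> points (tangent_bundle A) \<Longrightarrow>
    tangent_linear (tangent_space (tangent_bundle A) t) (tangent_space A (fst t)) (K t)"
  using K unfolding connection_map_def by blast

lemma K_tangent:
  "t \<in> points (tangent_bundle A) \<Longrightarrow> Y \<in> tangent_space (tangent_bundle A) t \<Longrightarrow>
    K t Y \<in> tangent_space A (fst t)"
  using K_linear unfolding tangent_linear_def by blast

lemma K_add:
  "t \<in> points (tangent_bundle A) \<Longrightarrow> Y \<in> tangent_space (tangent_bundle A) t \<Longrightarrow>
    Y' \<in> tangent_space (tangent_bundle A) t \<Longrightarrow> K t (tv_add Y Y') = tv_add (K t Y) (K t Y')"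
  using K_linear unfolding tangent_linear_def by blast

lemma K_scale:
  "t \<in> points (tangent_bundle A) \<Longrightarrow> Y \<in> tangent_space (tangent_bundle A) t \<Longrightarrow>
    K t (tv_scale r Y) = tv_scale r (K t Y)"
  using K_linear unfolding tangent_linear_def by blast

lemma K_section:
  "vector_field A X \<Longrightarrow> vector_field A Z \<Longrightarrow> p \<in> points A \<Longrightarrow>
    K (p, Z p) (pushforward (tangent_bundle A) (\<lambda>q. (q, Z q)) p (X p)) = D X Z p"
  using K unfolding connection_map_def by blast

lemma D_vector_field: "vector_field A X \<Longrightarrow> vector_field A Z \<Longrightarrow> vector_field A (D X Z)"
  using connection unfolding affine_connection_def by blast

lemma D_add:
  assumes "vector_field A X" "vector_field A Y" "vector_field A Z" "p \<in> points A"
  shows "D X (\<lambda>q. tv_add (Y q) (Z q)) p = tv_add (D X Y p) (D X Z p)"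
  using connection assms smooth_fun_const unfolding affine_connection_def by blast

lemma D_Leibniz:
  assumes "vector_field A X" "vector_field A Y" "smooth_fun A f" "p \<in> points A"
  shows "D X (\<lambda>q. tv_scale (f q) (Y q)) p = tv_add (tv_scale (f p) (D X Y p)) (tv_scale (X p f) (Y p))"
  using connection assms unfolding affine_connection_def by blast

lemma tangent_bundle_point:
  "p \<in> points A \<Longrightarrow> v \<in> tangent_space A p \<Longrightarrow> (p, v) \<in> points (tangent_bundle A)"
  by (simp add: points_tangent_bundle)

text \<open>The Christoffel symbols, read off from \<open>K\<close> instead of \<open>D\<close> so that no extension of
  coordinate fields enters: \<open>christoffel U \<phi> p a u\<close> is \<open>\<Gamma>\<^sub>x(a, u)\<close> at \<open>x = \<phi> p\<close>.\<close>

definition christoffel :: "'m set \<Rightarrow> ('m \<Rightarrow> 'e) \<Rightarrow> 'm \<Rightarrow> 'e \<Rightarrow> 'e \<Rightarrow> 'e" where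
  "christoffel U \<phi> p a u = components \<phi>
     (K (p, coord_vec A (U, \<phi>) p u) (lifted_coord_vec U \<phi> (p, coord_vec A (U, \<phi>) p u) (a, 0)))"

lemma K_horizontal:
  assumes U: "(U, \<phi>) \<in> A" "p \<in> U"
  shows "K (p, coord_vec A (U, \<phi>) p u) (lifted_coord_vec U \<phi> (p, coord_vec A (U, \<phi>) p u) (a, 0)) =
    coord_vec A (U, \<phi>) p (christoffel U \<phi> p a u)"
proof -
  let ?v = "coord_vec A (U, \<phi>) p u"
  have v: "?v \<in> tangent_space A p" by (rule coord_vec_in_tangent_space[OF U])
  have t: "(p, ?v) \<in> points (tangent_bundle A)" using v U chart_subset_points by (intro tangent_bundle_point) auto
  have "K (p, ?v) (lifted_coord_vec U \<phi> (p, ?v) (a, 0)) \<in> tangent_space A p"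
    using K_tangent[OF t TM.coord_vec_in_tangent_space[OF tangent_chartI[OF U(1)]]] U v by simp
  then show ?thesis unfolding christoffel_def using coord_vec_components[OF U] by simp
qed

text \<open>On \<open>N\<close> the cut-off coordinate field \<open>\<partial>\<^sub>u\<close> has constant components, so as a section it maps
  \<open>\<partial>\<^sub>a\<close> to the coordinate vector \<open>(a, 0)\<close>. The defining property of \<open>K\<close> therefore gives
  \<open>D \<partial>\<^sub>a \<partial>\<^sub>u = \<Gamma>(a, u)\<close>.\<close>

lemma D_cutoff:
  assumes \<beta>: "cutoff U \<phi> N \<beta>" and q: "q \<in> N"
  shows "D (cutoff_field U \<phi> \<beta> a) (cutoff_field U \<phi> \<beta> u) q = coord_vec A (U, \<phi>) q (christoffel U \<phi> q a u)"
proof -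
  let ?E = "cutoff_field U \<phi> \<beta>"
  have U: "(U, \<phi>) \<in> A" and N: "openin (atlas_topology A) N" "N \<subseteq> U" and \<beta>1: "\<And>q. q \<in> N \<Longrightarrow> \<beta> q = 1"
    using \<beta> unfolding cutoff_def by auto
  have qU: "q \<in> U" "q \<in> points A" using q N chart_subset_points[OF U] by auto
  have E: "?E b q = coord_vec A (U, \<phi>) q b" if "q \<in> N" for q b using \<beta>1[OF that] by (simp add: tv_scale_def)
  have "pushforward (tangent_bundle A) (\<lambda>q. (q, ?E u q)) q (coord_vec A (U, \<phi>) q a) =
      lifted_coord_vec U \<phi> (q, ?E u q) (a, 0)"
  proof (rule pushforward_section[OF U qU(1) N(1) q N(2), where \<zeta> = "\<lambda>_. u"])
    show "?E u q' \<in> tangent_space A q'" "u = components \<phi> (?E u q')" if "q' \<in> N" for q'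
      using E[OF that] coord_vec_in_tangent_space[OF U] components_coord_vec[OF U] that N(2) by auto
  qed (auto intro: smooth_on_const)
  then show ?thesis
    using K_section[OF cutoff_vector_field[OF \<beta>, of a] cutoff_vector_field[OF \<beta>, of u] qU(2)]
      K_horizontal[OF U qU(1)] by (simp add: E[OF q])
qed

text \<open>Apply the Leibniz rule to \<open>Z = \<partial>\<^sub>u + f \<partial>\<^sub>b\<close>, where \<open>f\<close> vanishes at \<open>p\<close> and has derivative \<open>1\<close>
  in some direction \<open>i\<close>. It turns \<open>K(Z\<^sub>* \<partial>\<^sub>i) = D \<partial>\<^sub>i Z\<close> at \<open>p\<close> into \<open>K(i, b) = K(i, 0) + b\<close>, and
  \<open>K(0, b) = b\<close> follows because \<open>K\<close> is linear on the fibre.\<close>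

lemma K_vertical:
  assumes U: "(U, \<phi>) \<in> A" "p \<in> U" and v: "v \<in> tangent_space A p"
  shows "K (p, v) (lifted_coord_vec U \<phi> (p, v) (0, b)) = coord_vec A (U, \<phi>) p b"
proof -
  obtain N \<beta> where \<beta>: "cutoff U \<phi> N \<beta>" and p: "p \<in> N" using cutoff_exists[OF Hausdorff U] .
  have N: "openin (atlas_topology A) N" "N \<subseteq> U" and \<beta>1: "\<And>q. q \<in> N \<Longrightarrow> \<beta> q = 1"
    using \<beta> unfolding cutoff_def by auto
  have op: "open (\<phi> ` N)" using openin_image_chart[OF N(1) U(1)] N(2) by (simp add: Int_absorb2)
  have pA: "p \<in> points A" using U chart_subset_points by auto
  define u where "u = components \<phi> v"
  have vu: "v = coord_vec A (U, \<phi>) p u" using coord_vec_components[OF U v] u_def by simp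
  let ?E = "cutoff_field U \<phi> \<beta>"
  have E: "?E c q = coord_vec A (U, \<phi>) q c" if "q \<in> N" for q c using \<beta>1[OF that] by (simp add: tv_scale_def)
  obtain i :: 'e where i: "i \<in> Basis" using nonempty_Basis by blast
  define f where "f q = \<beta> q * ((\<phi> q - \<phi> p) \<bullet> i)" for q
  have f_sm: "smooth_fun A f"
    unfolding f_def
  proof (rule cutoff_smooth_fun[OF \<beta>])
    show "smooth_on (\<phi> ` U) ((\<lambda>q. (\<phi> q - \<phi> p) \<bullet> i) \<circ> inv_into U \<phi>)"
      by (rule smooth_on_cong[of _ "\<lambda>x. (x - \<phi> p) \<bullet> i"])
        (auto intro!: smooth_on_inner smooth_on_diff smooth_on_ident smooth_on_const chart_open_image[OF U(1)]
          simp: chart_inv[OF U(1)])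
  qed
  have f0: "f p = 0" by (simp add: f_def)
  have f1: "coord_vec A (U, \<phi>) p i f = 1"
  proof -
    have "smooth_near A p f"
      using smooth_near_chartI[OF U smooth_fun_compose_chart[OF f_sm U(1)]] .
    moreover have "(f \<circ> inv_into U \<phi> has_derivative (\<lambda>a. a \<bullet> i)) (at (\<phi> p))"
      by (rule has_derivative_transform_within_open[of "\<lambda>x. (x - \<phi> p) \<bullet> i", OF _ op])
        (use p N(2) \<beta>1 chart_inv[OF U(1)] in \<open>auto simp: f_def subset_iff intro!: derivative_eq_intros\<close>)
    ultimately have "coord_vec A (U, \<phi>) p i f = i \<bullet> i" by (rule coord_vec_eqI[OF U])
    then show ?thesis using i by (simp add: inner_Basis)
  qed
  define Z where "Z q = tv_add (?E u q) (tv_scale (f q) (?E b q))" for q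
  have vf: "vector_field A (?E c)" for c by (rule cutoff_vector_field[OF \<beta>])
  have fE: "vector_field A (\<lambda>q. tv_scale (f q) (?E b q))" by (rule vector_field_scale[OF f_sm vf])
  have Z: "vector_field A Z" unfolding Z_def by (rule vector_field_add[OF vf fE])
  have Zp: "Z p = v" using f0 E[OF p] vu by (simp add: Z_def tv_add_def tv_scale_def)
  have push: "pushforward (tangent_bundle A) (\<lambda>q. (q, Z q)) p (coord_vec A (U, \<phi>) p i) =
      lifted_coord_vec U \<phi> (p, Z p) (i, (i \<bullet> i) *\<^sub>R b)"
  proof (rule pushforward_section[OF U N(1) p N(2),
        where \<zeta> = "\<lambda>x. u + ((x - \<phi> p) \<bullet> i) *\<^sub>R b" and \<zeta>' = "\<lambda>a. (a \<bullet> i) *\<^sub>R b"])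
    show "Z q \<in> tangent_space A q" if "q \<in> N" for q
      using vector_field_tangent[OF Z] that N(2) chart_subset_points[OF U(1)] by blast
    show "smooth_on (\<phi> ` N) (\<lambda>x. u + ((x - \<phi> p) \<bullet> i) *\<^sub>R b)"
      by (intro smooth_on_add smooth_on_scaleR smooth_on_inner smooth_on_diff smooth_on_ident smooth_on_const op)
    show "u + ((\<phi> q - \<phi> p) \<bullet> i) *\<^sub>R b = components \<phi> (Z q)" if "q \<in> N" for q
      using that N(2) by (auto simp: Z_def components_add components_scale E components_coord_vec[OF U(1)] f_def \<beta>1
          subset_iff simp del: split_paired_All)
    show "((\<lambda>x. u + ((x - \<phi> p) \<bullet> i) *\<^sub>R b) has_derivative (\<lambda>a. (a \<bullet> i) *\<^sub>R b)) (at (\<phi> p))"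
      by (auto intro!: derivative_eq_intros)
  qed
  have "K (p, v) (lifted_coord_vec U \<phi> (p, v) (i, b)) = D (?E i) Z p"
    using K_section[OF vf[of i] Z pA] push i by (simp add: E[OF p] Zp inner_Basis)
  also have "\<dots> = tv_add (D (?E i) (?E u) p) (D (?E i) (\<lambda>q. tv_scale (f q) (?E b q)) p)"
    unfolding Z_def by (rule D_add[OF vf vf fE pA])
  also have "D (?E i) (\<lambda>q. tv_scale (f q) (?E b q)) p = coord_vec A (U, \<phi>) p b"
    using D_Leibniz[OF vf[of i] vf[of b] f_sm pA] by (simp add: f0 f1 \<beta>1[OF p] tv_add_def tv_scale_def)
  also have "D (?E i) (?E u) p = K (p, v) (lifted_coord_vec U \<phi> (p, v) (i, 0))"
    using D_cutoff[OF \<beta> p] K_horizontal[OF U] vu by simp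
  finally have 1: "K (p, v) (lifted_coord_vec U \<phi> (p, v) (i, b)) =
    tv_add (K (p, v) (lifted_coord_vec U \<phi> (p, v) (i, 0))) (coord_vec A (U, \<phi>) p b)" .
  have TU: "(tdom U, tmap \<phi>) \<in> tangent_bundle A" "(p, v) \<in> tdom U"
    using tangent_chartI[OF U(1)] U v by auto
  have t: "(p, v) \<in> points (tangent_bundle A)" using tangent_bundle_point pA v by blast
  have "K (p, v) (lifted_coord_vec U \<phi> (p, v) ((i, 0) + (0, b))) =
    tv_add (K (p, v) (lifted_coord_vec U \<phi> (p, v) (i, 0))) (K (p, v) (lifted_coord_vec U \<phi> (p, v) (0, b)))"
    unfolding TM.coord_vec_add[OF TU] by (intro K_add t TM.coord_vec_in_tangent_space TU)
  then show ?thesis using 1 by (simp add: tv_add_def fun_eq_iff)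
qed

lemma K_coords:
  assumes U: "(U, \<phi>) \<in> A" "p \<in> U" and v: "v \<in> tangent_space A p"
  shows "K (p, v) (lifted_coord_vec U \<phi> (p, v) (a, b)) =
    coord_vec A (U, \<phi>) p (b + christoffel U \<phi> p a (components \<phi> v))"
proof -
  have TU: "(tdom U, tmap \<phi>) \<in> tangent_bundle A" "(p, v) \<in> tdom U"
    using tangent_chartI[OF U(1)] U v by auto
  have t: "(p, v) \<in> points (tangent_bundle A)" using tangent_bundle_point chart_subset_points U v by blast
  have "K (p, v) (lifted_coord_vec U \<phi> (p, v) ((0, b) + (a, 0))) =
    tv_add (K (p, v) (lifted_coord_vec U \<phi> (p, v) (0, b))) (K (p, v) (lifted_coord_vec U \<phi> (p, v) (a, 0)))"
    unfolding TM.coord_vec_add[OF TU] by (intro K_add t TM.coord_vec_in_tangent_space TU)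
  also have "K (p, v) (lifted_coord_vec U \<phi> (p, v) (a, 0)) =
      coord_vec A (U, \<phi>) p (christoffel U \<phi> p a (components \<phi> v))"
    using K_horizontal[OF U, of "components \<phi> v"] coord_vec_components[OF U v] by simp
  finally show ?thesis by (simp add: K_vertical[OF U v] coord_vec_add[OF U])
qed

lemma christoffel_linear_left:
  assumes U: "(U, \<phi>) \<in> A" "p \<in> U"
  shows "linear (\<lambda>a. christoffel U \<phi> p a u)"
proof -
  let ?v = "coord_vec A (U, \<phi>) p u"
  have v: "?v \<in> tangent_space A p" by (rule coord_vec_in_tangent_space[OF U])
  have TU: "(tdom U, tmap \<phi>) \<in> tangent_bundle A" "(p, ?v) \<in> tdom U"
    using tangent_chartI[OF U(1)] U v by auto
  have t: "(p, ?v) \<in> points (tangent_bundle A)" using tangent_bundle_point chart_subset_points U v by blast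
  have "lifted_coord_vec U \<phi> (p, ?v) (a + a', 0) =
    tv_add (lifted_coord_vec U \<phi> (p, ?v) (a, 0)) (lifted_coord_vec U \<phi> (p, ?v) (a', 0))" for a a'
    using TM.coord_vec_add[OF TU, of "(a, 0)" "(a', 0)"] by simp
  moreover have "lifted_coord_vec U \<phi> (p, ?v) (r *\<^sub>R a, 0) = tv_scale r (lifted_coord_vec U \<phi> (p, ?v) (a, 0))" for r a
    using TM.coord_vec_scale[OF TU, of r "(a, 0)"] by simp
  ultimately show ?thesis
    unfolding christoffel_def
    by (intro linearI) (simp_all add: K_add[OF t] K_scale[OF t] TM.coord_vec_in_tangent_space[OF TU]
        components_add components_scale)
qed

text \<open>Linearity in \<open>a\<close> comes from \<open>K\<close> being linear on each fibre, but varying \<open>u\<close> moves the base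
  point in \<open>TM\<close>. Linearity in \<open>u\<close> is inherited from the covariant derivative instead: homogeneity is
  the Leibniz rule for a constant function, whose derivative vanishes.\<close>

lemma christoffel_linear_right:
  assumes U: "(U, \<phi>) \<in> A" "p \<in> U"
  shows "linear (christoffel U \<phi> p a)"
proof -
  obtain N \<beta> where \<beta>: "cutoff U \<phi> N \<beta>" and p: "p \<in> N" using cutoff_exists[OF Hausdorff U] .
  have pA: "p \<in> points A" using U chart_subset_points by auto
  let ?E = "cutoff_field U \<phi> \<beta>"
  have vf: "vector_field A (?E c)" for c by (rule cutoff_vector_field[OF \<beta>])
  have \<Gamma>: "christoffel U \<phi> p a u = components \<phi> (D (?E a) (?E u) p)" for u
    using D_cutoff[OF \<beta> p] components_coord_vec[OF U] by simp
  have out: "\<beta> q = 0" if "q \<notin> U" for q using \<beta> that unfolding cutoff_def by auto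
  have "?E (u + u') q = tv_add (?E u q) (?E u' q)" for u u' q
    by (cases "q \<in> U") (auto simp: coord_vec_add[OF U(1)] out tv_scale_def tv_add_def distrib_left)
  then have "christoffel U \<phi> p a (u + u') = christoffel U \<phi> p a u + christoffel U \<phi> p a u'" for u u'
    unfolding \<Gamma> using D_add[OF vf[of a] vf[of u] vf[of u'] pA] by (simp add: components_add)
  moreover have "christoffel U \<phi> p a (r *\<^sub>R u) = r *\<^sub>R christoffel U \<phi> p a u" for r u
  proof -
    have "coord_vec A (U, \<phi>) q c (\<lambda>_. r) = 0" for q c
      by (simp add: coord_vec_def comp_def frechet_derivative_const)
    then have "?E a p (\<lambda>_. r) = 0" by (simp add: tv_scale_def)
    moreover have "?E (r *\<^sub>R u) q = tv_scale r (?E u q)" for q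
      by (cases "q \<in> U") (auto simp: coord_vec_scale[OF U(1)] out tv_scale_def)
    ultimately show ?thesis
      unfolding \<Gamma> using D_Leibniz[OF vf[of a] vf[of u] smooth_fun_const[of r] pA]
      by (simp add: components_add components_scale)
  qed
  ultimately show ?thesis by (rule linearI)
qed

text \<open>Locally the Christoffel symbols are components of the covariant derivative of two global
  vector fields, and this derivative is a vector field.\<close>

lemma christoffel_smooth:
  assumes U: "(U, \<phi>) \<in> A"
  shows "smooth_on (\<phi> ` U) (\<lambda>x. christoffel U \<phi> (inv_into U \<phi> x) a u)"
proof (rule smooth_on_local)
  fix x assume "x \<in> \<phi> ` U"
  then obtain p where p: "p \<in> U" "x = \<phi> p" by blast
  obtain N \<beta> where \<beta>: "cutoff U \<phi> N \<beta>" and pN: "p \<in> N" using cutoff_exists[OF Hausdorff U p(1)] .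
  have N: "openin (atlas_topology A) N" "N \<subseteq> U" using \<beta> unfolding cutoff_def by auto
  have op: "open (\<phi> ` N)" using openin_image_chart[OF N(1) U] N(2) by (simp add: Int_absorb2)
  have "smooth_on (\<phi> ` N)
      (\<lambda>x. components \<phi> (D (cutoff_field U \<phi> \<beta> a) (cutoff_field U \<phi> \<beta> u) (inv_into U \<phi> x)))"
    by (rule smooth_on_subset[OF vector_field_smooth[OF D_vector_field[OF cutoff_vector_field[OF \<beta>]
            cutoff_vector_field[OF \<beta>]] U]]) (use N(2) in auto)
  then have "smooth_on (\<phi> ` N) (\<lambda>x. christoffel U \<phi> (inv_into U \<phi> x) a u)"
    by (rule smooth_on_cong[OF op, rotated])
      (use N(2) in \<open>auto simp: D_cutoff[OF \<beta>] chart_inv[OF U] components_coord_vec[OF U] subset_iff\<close>)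
  then show "\<exists>T. open T \<and> x \<in> T \<and> smooth_on T (\<lambda>x. christoffel U \<phi> (inv_into U \<phi> x) a u)"
    using op pN p by blast
qed

end

section \<open>Operators on the horizontal-vertical splitting\<close>

abbreviation tangent_endo :: "('m, 'e::euclidean_space) chart set \<Rightarrow> ('m \<Rightarrow> 'm tvec \<Rightarrow> 'm tvec) \<Rightarrow> bool" where
  "tangent_endo A Q \<equiv> \<forall>p\<in>points A. tangent_linear (tangent_space A p) (tangent_space A p) (Q p)"

lemma tangent_endoD:
  assumes "tangent_endo A Q" "p \<in> points A" "u \<in> tangent_space A p"
  shows "Q p u \<in> tangent_space A p" "Q p (tv_scale r u) = tv_scale r (Q p u)"
    "v \<in> tangent_space A p \<Longrightarrow> Q p (tv_add u v) = tv_add (Q p u) (Q p v)"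
  using assms unfolding tangent_linear_def by blast+

lemma tensor_field_11_endo: "tensor_field_11 A Q \<Longrightarrow> tangent_endo A Q"
  unfolding tensor_field_11_def by blast

lemma pushforward_add: "pushforward B F p (tv_add u v) = tv_add (pushforward B F p u) (pushforward B F p v)"
  by (auto simp: pushforward_def tv_add_def)

lemma pushforward_scale: "pushforward B F p (tv_scale r u) = tv_scale r (pushforward B F p u)"
  by (auto simp: pushforward_def tv_scale_def)

context manifold_connection begin

abbreviation proj :: "'m \<times> 'm tvec \<Rightarrow> ('m \<times> 'm tvec) tvec \<Rightarrow> 'm tvec" where
  "proj t Y \<equiv> pushforward A fst t Y"

lemma tangent_bundle_pointE:
  assumes "t \<in> points (tangent_bundle A)"
  obtains p v U \<phi> where "t = (p, v)" "(U, \<phi>) \<in> A" "p \<in> U" "v \<in> tangent_space A p"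
    "(tdom U, tmap \<phi>) \<in> tangent_bundle A" "(p, v) \<in> tdom U"
proof -
  obtain p v where t: "t = (p, v)" "p \<in> points A" "v \<in> tangent_space A p"
    using assms unfolding points_tangent_bundle by blast
  obtain U \<phi> where "(U, \<phi>) \<in> A" "p \<in> U" using points_chart[OF t(2)] .
  then show thesis using that t tangent_chartI by blast
qed

lemma fst_point: "t \<in> points (tangent_bundle A) \<Longrightarrow> fst t \<in> points A"
  unfolding points_tangent_bundle by auto

lemma proj_tangent:
  assumes "t \<in> points (tangent_bundle A)" "Y \<in> tangent_space (tangent_bundle A) t"
  shows "proj t Y \<in> tangent_space A (fst t)"
proof -
  obtain p v U \<phi> where t: "t = (p, v)" "(U, \<phi>) \<in> A" "p \<in> U" "v \<in> tangent_space A p"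
    "(tdom U, tmap \<phi>) \<in> tangent_bundle A" "(p, v) \<in> tdom U" using assms(1) by (rule tangent_bundle_pointE)
  obtain a b where "Y = lifted_coord_vec U \<phi> (p, v) (a, b)"
    using assms(2) unfolding t(1) TM.tangent_space_chart[OF t(5,6)] by auto
  then show ?thesis using t pushforward_fst coord_vec_in_tangent_space by simp
qed

text \<open>In coordinates \<open>Y \<mapsto> (\<pi>\<^sub>*Y, KY)\<close> is \<open>(a, b) \<mapsto> (a, b + \<Gamma>\<^sub>x(a, u))\<close>, a shear and hence a
  bijection \<open>T\<^sub>t(TM) \<rightarrow> T\<^sub>pM \<oplus> T\<^sub>pM\<close>.\<close>

lemma splitting_bij:
  assumes t: "t \<in> points (tangent_bundle A)" and "h \<in> tangent_space A (fst t)" "k \<in> tangent_space A (fst t)"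
  shows "\<exists>!Y. Y \<in> tangent_space (tangent_bundle A) t \<and> proj t Y = h \<and> K t Y = k"
proof -
  obtain p v U \<phi> where t: "t = (p, v)" and U: "(U, \<phi>) \<in> A" "p \<in> U" and v: "v \<in> tangent_space A p"
    and TU: "(tdom U, tmap \<phi>) \<in> tangent_bundle A" "(p, v) \<in> tdom U" using t by (rule tangent_bundle_pointE)
  let ?\<Gamma> = "\<lambda>a. christoffel U \<phi> p a (components \<phi> v)"
  have hk: "h \<in> tangent_space A p" "k \<in> tangent_space A p" using assms t by auto
  have eq: "coord_vec A (U, \<phi>) p a = w \<longleftrightarrow> a = components \<phi> w" if "w \<in> tangent_space A p" for a w
    using components_coord_vec[OF U] coord_vec_components[OF U that] by auto
  have iff: "proj t (lifted_coord_vec U \<phi> t z) = h \<and> K t (lifted_coord_vec U \<phi> t z) = k \<longleftrightarrow>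
      z = (components \<phi> h, components \<phi> k - ?\<Gamma> (components \<phi> h))" for z
    by (cases z) (auto simp: t pushforward_fst[OF U v] K_coords[OF U v] eq[OF hk(1)] eq[OF hk(2)] eq_diff_eq)
  have range: "tangent_space (tangent_bundle A) t = range (lifted_coord_vec U \<phi> t)"
    unfolding t by (rule TM.tangent_space_chart[OF TU])
  let ?z = "(components \<phi> h, components \<phi> k - ?\<Gamma> (components \<phi> h))"
  show ?thesis
  proof (rule ex1I)
    show "lifted_coord_vec U \<phi> t ?z \<in> tangent_space (tangent_bundle A) t \<and>
        proj t (lifted_coord_vec U \<phi> t ?z) = h \<and> K t (lifted_coord_vec U \<phi> t ?z) = k"
      unfolding iff range by blast
    fix Y assume Y: "Y \<in> tangent_space (tangent_bundle A) t \<and> proj t Y = h \<and> K t Y = k"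
    then obtain z where z: "Y = lifted_coord_vec U \<phi> t z" unfolding range by blast
    show "Y = lifted_coord_vec U \<phi> t ?z" using Y iff[of z] unfolding z by metis
  qed
qed

lemma splitting_eqI:
  assumes "t \<in> points (tangent_bundle A)"
    and "Y \<in> tangent_space (tangent_bundle A) t" "Y' \<in> tangent_space (tangent_bundle A) t"
    and "proj t Y = proj t Y'" "K t Y = K t Y'"
  shows "Y = Y'"
  using splitting_bij[OF assms(1) proj_tangent[OF assms(1,3)] K_tangent[OF assms(1,3)]] assms(2-5) by blast

definition splitting_inv :: "'m \<times> 'm tvec \<Rightarrow> 'm tvec \<Rightarrow> 'm tvec \<Rightarrow> ('m \<times> 'm tvec) tvec" where
  "splitting_inv t h k = (THE Y. Y \<in> tangent_space (tangent_bundle A) t \<and> proj t Y = h \<and> K t Y = k)"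

lemma splitting_inv:
  assumes "t \<in> points (tangent_bundle A)" "h \<in> tangent_space A (fst t)" "k \<in> tangent_space A (fst t)"
  shows "splitting_inv t h k \<in> tangent_space (tangent_bundle A) t"
    "proj t (splitting_inv t h k) = h" "K t (splitting_inv t h k) = k"
  using theI'[OF splitting_bij[OF assms]] unfolding splitting_inv_def by blast+

text \<open>The operator \<open>m \<otimes> Q\<close> on \<open>T\<^sub>t(TM) \<cong> \<real>\<^sup>2 \<otimes> T\<^sub>pM\<close>, where \<open>m\<close> is the matrix with rows \<open>(a, b)\<close> and
  \<open>(c, d)\<close>.\<close>

definition split_op :: "('m \<Rightarrow> 'm tvec \<Rightarrow> 'm tvec) \<Rightarrow> real \<Rightarrow> real \<Rightarrow> real \<Rightarrow> real \<Rightarrow>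
    'm \<times> 'm tvec \<Rightarrow> ('m \<times> 'm tvec) tvec \<Rightarrow> ('m \<times> 'm tvec) tvec" where
  "split_op Q a b c d t Y = splitting_inv t
     (tv_add (tv_scale a (Q (fst t) (proj t Y))) (tv_scale b (Q (fst t) (K t Y))))
     (tv_add (tv_scale c (Q (fst t) (proj t Y))) (tv_scale d (Q (fst t) (K t Y))))"

lemma split_op:
  assumes Q: "tangent_endo A Q" and t: "t \<in> points (tangent_bundle A)" "Y \<in> tangent_space (tangent_bundle A) t"
  shows "split_op Q a b c d t Y \<in> tangent_space (tangent_bundle A) t"
    "proj t (split_op Q a b c d t Y) =
      tv_add (tv_scale a (Q (fst t) (proj t Y))) (tv_scale b (Q (fst t) (K t Y)))"
    "K t (split_op Q a b c d t Y) =
      tv_add (tv_scale c (Q (fst t) (proj t Y))) (tv_scale d (Q (fst t) (K t Y)))"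
  unfolding split_op_def
  by (intro splitting_inv t tangent_space_add tangent_space_scale tangent_endoD(1)[OF Q] fst_point
      proj_tangent K_tangent)+

lemma split_op_compose:
  assumes Q: "tangent_endo A Q" and R: "tangent_endo A R"
    and t: "t \<in> points (tangent_bundle A)" "Y \<in> tangent_space (tangent_bundle A) t"
  shows "split_op Q a b c d t (split_op R a' b' c' d' t Y) =
    split_op (\<lambda>p v. Q p (R p v)) (a * a' + b * c') (a * b' + b * d') (c * a' + d * c') (c * b' + d * d') t Y"
proof (rule splitting_eqI[OF t(1)])
  have QR: "tangent_endo A (\<lambda>p v. Q p (R p v))"
    using Q R unfolding tangent_linear_def by simp
  note p = fst_point[OF t(1)]
  note RY = tangent_endoD(1)[OF R p proj_tangent[OF t]] tangent_endoD(1)[OF R p K_tangent[OF t]]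
  note simps = split_op[OF Q t(1) split_op(1)[OF R t]] split_op[OF R t] split_op[OF QR t]
    tangent_endoD[OF Q p] RY tangent_space_scale[OF p]
  show "split_op Q a b c d t (split_op R a' b' c' d' t Y) \<in> tangent_space (tangent_bundle A) t"
    "split_op (\<lambda>p v. Q p (R p v)) (a * a' + b * c') (a * b' + b * d') (c * a' + d * c') (c * b' + d * d') t Y
      \<in> tangent_space (tangent_bundle A) t"
    by (simp_all only: simps)
  show "proj t (split_op Q a b c d t (split_op R a' b' c' d' t Y)) = proj t (split_op (\<lambda>p v. Q p (R p v))
      (a * a' + b * c') (a * b' + b * d') (c * a' + d * c') (c * b' + d * d') t Y)"
    "K t (split_op Q a b c d t (split_op R a' b' c' d' t Y)) = K t (split_op (\<lambda>p v. Q p (R p v))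
      (a * a' + b * c') (a * b' + b * d') (c * a' + d * c') (c * b' + d * d') t Y)"
    by (simp_all add: simps) (simp_all add: tv_add_def tv_scale_def algebra_simps)
qed

lemma split_op_cong:
  assumes "\<And>u. u \<in> tangent_space A (fst t) \<Longrightarrow> Q (fst t) u = R (fst t) u"
    and "t \<in> points (tangent_bundle A)" "Y \<in> tangent_space (tangent_bundle A) t"
  shows "split_op Q a b c d t Y = split_op R a b c d t Y"
  unfolding split_op_def using assms proj_tangent K_tangent by simp

lemma tangent_endo_id: "tangent_endo A (\<lambda>p v. v)"
  by (simp add: tangent_linear_def)

lemma split_op_id:
  assumes t: "t \<in> points (tangent_bundle A)" "Y \<in> tangent_space (tangent_bundle A) t"
  shows "split_op (\<lambda>p v. v) r 0 0 r t Y = tv_scale r Y"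
  by (rule splitting_eqI[OF t(1)])
    (simp_all add: split_op[OF tangent_endo_id t] TM.tangent_space_scale t pushforward_scale K_scale,
      simp_all add: tv_add_def tv_scale_def)

lemma split_op_minus:
  assumes Q: "tangent_endo A Q" and t: "t \<in> points (tangent_bundle A)" "Y \<in> tangent_space (tangent_bundle A) t"
  shows "tv_scale (-1) (split_op Q a b c d t Y) = split_op Q (- a) (- b) (- c) (- d) t Y"
  by (rule splitting_eqI[OF t(1)])
    (simp_all add: split_op[OF Q t] TM.tangent_space_scale t pushforward_scale K_scale,
      simp_all add: tv_add_def tv_scale_def)

text \<open>On the diagonal of \<open>T\<^sub>pM \<oplus> T\<^sub>pM\<close> the first component of \<open>m \<otimes> Q\<close> is \<open>(a + b) Q\<close>.\<close>

lemma split_op_scalar_imp: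
  assumes Q: "tangent_endo A Q"
    and r: "\<And>t Y. t \<in> points (tangent_bundle A) \<Longrightarrow> Y \<in> tangent_space (tangent_bundle A) t \<Longrightarrow>
      split_op Q a b c d t Y = tv_scale r Y"
    and p: "p \<in> points A" "u \<in> tangent_space A p"
  shows "tv_scale (a + b) (Q p u) = tv_scale r u"
proof -
  let ?t = "(p, u)"
  let ?Y = "splitting_inv ?t u u"
  have t: "?t \<in> points (tangent_bundle A)" using p by (rule tangent_bundle_point)
  have Y: "?Y \<in> tangent_space (tangent_bundle A) ?t" "proj ?t ?Y = u" "K ?t ?Y = u"
    using splitting_inv[OF t] p by auto
  have "tv_scale (a + b) (Q p u) = proj ?t (split_op Q a b c d ?t ?Y)"
    unfolding split_op[OF Q t Y(1)] Y(2,3) by (simp add: tv_add_def tv_scale_def distrib_right)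
  also have "\<dots> = tv_scale r u" unfolding r[OF t Y(1)] pushforward_scale Y(2) ..
  finally show ?thesis .
qed

text \<open>Read in a chart, \<open>x\<close> and \<open>y + \<Gamma> x\<close> are the horizontal and the vertical part of the argument
  \<open>(x, y)\<close>, and the final \<open>- \<Gamma> H\<close> undoes the shear.\<close>

lemma split_op_coords:
  assumes Q: "tangent_endo A Q" and U: "(U, \<phi>) \<in> A" "p \<in> U" and v: "v \<in> tangent_space A p"
    and \<rho>: "\<And>w. \<rho> w = components \<phi> (Q p (coord_vec A (U, \<phi>) p w))"
    and \<Gamma>: "\<And>a. \<Gamma> a = christoffel U \<phi> p a (components \<phi> v)"
    and H: "H = a *\<^sub>R \<rho> x + b *\<^sub>R \<rho> (y + \<Gamma> x)"
  shows "split_op Q a b c d (p, v) (lifted_coord_vec U \<phi> (p, v) (x, y)) =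
    lifted_coord_vec U \<phi> (p, v) (H, c *\<^sub>R \<rho> x + d *\<^sub>R \<rho> (y + \<Gamma> x) - \<Gamma> H)"
proof -
  have pA: "p \<in> points A" using U chart_subset_points by auto
  have t: "(p, v) \<in> points (tangent_bundle A)" using tangent_bundle_point[OF pA v] .
  have TU: "(tdom U, tmap \<phi>) \<in> tangent_bundle A" "(p, v) \<in> tdom U" using tangent_chartI[OF U(1)] U v by auto
  note T = TM.coord_vec_in_tangent_space[OF TU]
  have Q\<rho>: "Q p (coord_vec A (U, \<phi>) p w) = coord_vec A (U, \<phi>) p (\<rho> w)" for w
    unfolding \<rho> by (intro coord_vec_components[OF U, symmetric] tangent_endoD(1)[OF Q pA] coord_vec_in_tangent_space U)
  then have "Q p (tv_add (coord_vec A (U, \<phi>) p w) (coord_vec A (U, \<phi>) p w')) =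
      coord_vec A (U, \<phi>) p (\<rho> (w + w'))" for w w'
    by (simp flip: coord_vec_add[OF U])
  then show ?thesis
    by (intro splitting_eqI[OF t])
      (simp_all add: split_op[OF Q t T] T pushforward_fst[OF U v] K_coords[OF U v] Q\<rho> H
        coord_vec_add[OF U] coord_vec_scale[OF U] flip: \<Gamma>)
qed

text \<open>By the coordinate formula, the coefficients of \<open>m \<otimes> Q\<close> are composed of those of \<open>Q\<close>, which
  depend on the base point only, and of Christoffel symbols \<open>\<Gamma>\<^sub>x(a, u)\<close>, which depend linearly on the
  fibre coordinate \<open>u\<close>. Hence they are smooth.\<close>

lemma tensor_field_split_op:
  assumes Q: "tensor_field_11 A Q"
  shows "tensor_field_11 (tangent_bundle A) (split_op Q a b c d)"
proof -
  note endo = tensor_field_11_endo[OF Q]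
  have "tangent_linear (tangent_space (tangent_bundle A) t) (tangent_space (tangent_bundle A) t) (split_op Q a b c d t)"
    if t: "t \<in> points (tangent_bundle A)" for t
    unfolding tangent_linear_def
  proof (intro conjI ballI allI)
    fix Y Y' r assume Y: "Y \<in> tangent_space (tangent_bundle A) t" "Y' \<in> tangent_space (tangent_bundle A) t"
    note simps = split_op[OF endo t] TM.tangent_space_add[OF t] TM.tangent_space_scale[OF t] Y
      pushforward_add pushforward_scale K_add[OF t] K_scale[OF t] tangent_endoD[OF endo fst_point[OF t]]
      proj_tangent[OF t] K_tangent[OF t]
    show "split_op Q a b c d t (tv_add Y Y') = tv_add (split_op Q a b c d t Y) (split_op Q a b c d t Y')"
      by (rule splitting_eqI[OF t]) (simp_all add: simps, simp_all add: tv_add_def tv_scale_def algebra_simps)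
  next
    fix r Y assume Y: "Y \<in> tangent_space (tangent_bundle A) t"
    note simps = split_op[OF endo t] TM.tangent_space_scale[OF t] Y
      pushforward_scale K_scale[OF t] tangent_endoD[OF endo fst_point[OF t]]
      proj_tangent[OF t] K_tangent[OF t]
    show "split_op Q a b c d t (tv_scale r Y) = tv_scale r (split_op Q a b c d t Y)"
      by (rule splitting_eqI[OF t]) (simp_all add: simps, simp_all add: tv_add_def tv_scale_def algebra_simps)
  qed (rule split_op(1)[OF endo t])
  moreover have "smooth_on (\<Phi> ` U') (\<lambda>z. components \<Phi> (split_op Q a b c d (inv_into U' \<Phi> z)
      (coord_vec (tangent_bundle A) (U', \<Phi>) (inv_into U' \<Phi> z) w)))"
    if U': "(U', \<Phi>) \<in> tangent_bundle A" for U' \<Phi> w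
  proof -
    obtain U \<phi> where U: "(U, \<phi>) \<in> A" and U'_eq: "U' = tdom U" "\<Phi> = tmap \<phi>" using U' by (rule tangent_chartE)
    obtain \<alpha> \<beta> where w: "w = (\<alpha>, \<beta>)" by (cases w)
    let ?q = "inv_into U \<phi>"
    let ?D = "\<phi> ` U \<times> (UNIV :: 'e set)"
    have op: "open ?D" using chart_open_image[OF U] by (simp add: open_Times)
    have im: "tmap \<phi> ` tdom U = ?D" using tmap_image[OF U] by simp
    have q: "?q (fst z) \<in> U" if "z \<in> ?D" for z using that chart_inv[OF U] by auto
    have base: "smooth_on ?D (\<lambda>z. f (fst z))" if "smooth_on (\<phi> ` U) f" for f :: "'e \<Rightarrow> 'e"
      by (rule smooth_on_compose[OF op _ smooth_on_fst[OF op smooth_on_ident[OF op]] that]) auto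
    define \<rho> where "\<rho> z x = components \<phi> (Q (?q (fst z)) (coord_vec A (U, \<phi>) (?q (fst z)) x))" for z :: "'e \<times> 'e" and x
    define \<Gamma> where "\<Gamma> z x = christoffel U \<phi> (?q (fst z)) x (snd z)" for z :: "'e \<times> 'e" and x
    have \<rho>: "smooth_on ?D (\<lambda>z. \<rho> z (f z))" if "smooth_on ?D f" for f
    proof (rule smooth_on_linear_family[OF op _ _ that])
      show "linear (\<rho> z)" if z: "z \<in> ?D" for z
        unfolding \<rho>_def using q[OF z] chart_subset_points[OF U] coord_vec_in_tangent_space[OF U q[OF z]]
        by (intro linearI) (auto simp: coord_vec_add[OF U q[OF z]] coord_vec_scale[OF U q[OF z]]
            tangent_endoD[OF endo] components_add components_scale subset_iff)
      show "smooth_on ?D (\<lambda>z. \<rho> z x)" for x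
        unfolding \<rho>_def by (rule base) (use Q U in \<open>auto simp: tensor_field_11_def\<close>)
    qed
    have \<Gamma>: "smooth_on ?D (\<lambda>z. \<Gamma> z (f z))" if "smooth_on ?D f" for f
    proof (rule smooth_on_linear_family[OF op _ _ that])
      show "linear (\<Gamma> z)" if "z \<in> ?D" for z
        unfolding \<Gamma>_def by (rule christoffel_linear_left[OF U q[OF that]])
      show "smooth_on ?D (\<lambda>z. \<Gamma> z x)" for x
        unfolding \<Gamma>_def
        by (rule smooth_on_linear_family[OF op christoffel_linear_right[OF U q] base[OF christoffel_smooth[OF U]]
              smooth_on_snd[OF op smooth_on_ident[OF op]]])
    qed
    define H where "H z = a *\<^sub>R \<rho> z \<alpha> + b *\<^sub>R \<rho> z (\<beta> + \<Gamma> z \<alpha>)" for z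
    have \<rho>\<alpha>: "smooth_on ?D (\<lambda>z. \<rho> z \<alpha>)" by (rule \<rho>[OF smooth_on_const])
    have \<rho>\<kappa>: "smooth_on ?D (\<lambda>z. \<rho> z (\<beta> + \<Gamma> z \<alpha>))"
      by (rule \<rho>[OF smooth_on_add[OF op smooth_on_const \<Gamma>[OF smooth_on_const]]])
    have H: "smooth_on ?D H"
      unfolding H_def by (intro smooth_on_add smooth_on_scaleR smooth_on_const op \<rho>\<alpha> \<rho>\<kappa>)
    have "smooth_on ?D (\<lambda>z. (H z, c *\<^sub>R \<rho> z \<alpha> + d *\<^sub>R \<rho> z (\<beta> + \<Gamma> z \<alpha>) - \<Gamma> z (H z)))"
      by (intro smooth_on_Pair smooth_on_diff smooth_on_add smooth_on_scaleR smooth_on_const op \<rho>\<alpha> \<rho>\<kappa> H \<Gamma>[OF H])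
    then have "smooth_on ?D (\<lambda>z. components (tmap \<phi>) (split_op Q a b c d (inv_into (tdom U) (tmap \<phi>) z)
      (lifted_coord_vec U \<phi> (inv_into (tdom U) (tmap \<phi>) z) (\<alpha>, \<beta>))))"
    proof (rule smooth_on_cong[OF op, rotated])
      fix z assume z: "z \<in> ?D"
      let ?v = "coord_vec A (U, \<phi>) (?q (fst z)) (snd z)"
      have v: "?v \<in> tangent_space A (?q (fst z))" by (rule coord_vec_in_tangent_space[OF U q[OF z]])
      have inv: "inv_into (tdom U) (tmap \<phi>) z = (?q (fst z), ?v)"
        using tmap_inv[OF U, of "fst z" "snd z"] z by auto
      have "\<Gamma> z x = christoffel U \<phi> (?q (fst z)) x (components \<phi> ?v)" for x
        unfolding \<Gamma>_def components_coord_vec[OF U q[OF z]] ..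
      note coords = split_op_coords[OF endo U q[OF z] v \<rho>_def this H_def, where c = c and d = d]
      show "(H z, c *\<^sub>R \<rho> z \<alpha> + d *\<^sub>R \<rho> z (\<beta> + \<Gamma> z \<alpha>) - \<Gamma> z (H z)) =
        components (tmap \<phi>) (split_op Q a b c d (inv_into (tdom U) (tmap \<phi>) z)
          (lifted_coord_vec U \<phi> (inv_into (tdom U) (tmap \<phi>) z) (\<alpha>, \<beta>)))"
        unfolding inv coords
        by (rule TM.components_coord_vec[OF tangent_chartI[OF U], symmetric]) (use q[OF z] v in auto)
    qed
    then show ?thesis unfolding U'_eq im w .
  qed
  ultimately show ?thesis unfolding tensor_field_11_def by blast
qed

lemma tensor_field_id: "tensor_field_11 A (\<lambda>p v. v)"
proof -
  have "smooth_on (\<phi> ` U) (\<lambda>x. components \<phi> (coord_vec A (U, \<phi>) (inv_into U \<phi> x) a))"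
    if U: "(U, \<phi>) \<in> A" for U \<phi> a
    by (rule smooth_on_cong[OF chart_open_image[OF U] _ smooth_on_const[of _ a]])
      (auto simp: chart_inv[OF U] components_coord_vec[OF U])
  then show ?thesis using tangent_endo_id unfolding tensor_field_11_def by blast
qed

text \<open>The Sasakian metric is the tensor product of the Euclidean metric of \<open>\<real>\<^sup>2\<close> with \<open>g\<close>, so an
  orthogonal matrix \<open>m\<close> makes \<open>m \<otimes> Q\<close> behave like \<open>Q\<close>.\<close>

lemma split_op_metric_compatible:
  assumes Q: "tangent_endo A Q" and g: "tensor_field_02 A g"
    and compat: "\<And>p u v. p \<in> points A \<Longrightarrow> u \<in> tangent_space A p \<Longrightarrow> v \<in> tangent_space A p \<Longrightarrow>
      g p (Q p u) (Q p v) = \<epsilon> * g p u v"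
    and G: "\<And>t X Y. t \<in> points (tangent_bundle A) \<Longrightarrow> X \<in> tangent_space (tangent_bundle A) t \<Longrightarrow>
      Y \<in> tangent_space (tangent_bundle A) t \<Longrightarrow>
      G t X Y = g (fst t) (K t X) (K t Y) + g (fst t) (proj t X) (proj t Y)"
    and orth: "a * a + c * c = 1" "b * b + d * d = 1" "a * b + c * d = 0"
  shows "metric_compatible (tangent_bundle A) G \<epsilon> (split_op Q a b c d)"
  unfolding metric_compatible_def
proof (intro allI impI ballI)
  fix X' Y' t assume fields: "vector_field (tangent_bundle A) X'" "vector_field (tangent_bundle A) Y'"
    and t: "t \<in> points (tangent_bundle A)"
  define X Y where "X = X' t" and "Y = Y' t"
  have XY: "X \<in> tangent_space (tangent_bundle A) t" "Y \<in> tangent_space (tangent_bundle A) t"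
    unfolding X_def Y_def using TM.vector_field_tangent fields t by auto
  let ?p = "fst t"
  note p = fst_point[OF t]
  have lin: "g ?p (tv_add (tv_scale r u) (tv_scale s v)) (tv_add (tv_scale r u') (tv_scale s v')) =
      r * r * g ?p u u' + r * s * (g ?p u v' + g ?p v u') + s * s * g ?p v v'"
    if "u \<in> tangent_space A ?p" "v \<in> tangent_space A ?p" "u' \<in> tangent_space A ?p" "v' \<in> tangent_space A ?p"
    for r s u v u' v'
    using g p that unfolding tensor_field_02_def
    by (simp add: tangent_space_add[OF p] tangent_space_scale[OF p] algebra_simps)
  note mem = proj_tangent[OF t XY(1)] proj_tangent[OF t XY(2)] K_tangent[OF t XY(1)] K_tangent[OF t XY(2)]
  note Qmem = mem[THEN tangent_endoD(1)[OF Q p]]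
  define hh hk kh kk where "hh = \<epsilon> * g ?p (proj t X) (proj t Y)" and "hk = \<epsilon> * g ?p (proj t X) (K t Y)"
    and "kh = \<epsilon> * g ?p (K t X) (proj t Y)" and "kk = \<epsilon> * g ?p (K t X) (K t Y)"
  have "G t (split_op Q a b c d t X) (split_op Q a b c d t Y) =
      c * c * hh + c * d * (hk + kh) + d * d * kk + (a * a * hh + a * b * (hk + kh) + b * b * kk)"
    unfolding G[OF t split_op(1)[OF Q t XY(1)] split_op(1)[OF Q t XY(2)]] split_op[OF Q t XY(1)] split_op[OF Q t XY(2)]
      lin[OF Qmem(1,3,2,4)] hh_def hk_def kh_def kk_def compat[OF p mem(1,2)] compat[OF p mem(1,4)]
      compat[OF p mem(3,2)] compat[OF p mem(3,4)] ..
  also have "\<dots> = (a * a + c * c) * hh + (a * b + c * d) * (hk + kh) + (b * b + d * d) * kk"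
    by (simp add: algebra_simps)
  also have "\<dots> = \<epsilon> * G t X Y"
    unfolding orth G[OF t XY] by (simp add: hh_def kk_def algebra_simps)
  finally show "G t (split_op Q a b c d t (X' t)) (split_op Q a b c d t (Y' t)) = \<epsilon> * G t (X' t) (Y' t)"
    unfolding X_def Y_def .
qed

end

section \<open>The para-hypercomplex structure of the tangent bundle\<close>

theorem theorem3p2:
  fixes A :: "('m, 'e::euclidean_space) chart set"
    and P :: "'m \<Rightarrow> 'm tvec \<Rightarrow> 'm tvec"
    and g :: "'m \<Rightarrow> 'm tvec \<Rightarrow> 'm tvec \<Rightarrow> real"
    and G :: "'m \<times> 'm tvec \<Rightarrow> ('m \<times> 'm tvec) tvec \<Rightarrow> ('m \<times> 'm tvec) tvec \<Rightarrow> real"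
  assumes "almost_para_hermitian A P g"
    and "sasakian_metric A g G"
  shows "\<exists>H. almost_para_hypercomplex (tangent_bundle A) H \<and>
             para_hyperhermitian (tangent_bundle A) G H"
proof -
  have M: "smooth_manifold A" and P: "almost_product_structure A P"
    and g: "semi_riemannian_metric A g" and gP: "metric_compatible A g (-1) P"
    using assms(1) unfolding almost_para_hermitian_def by auto
  obtain D K where D: "levi_civita_connection A g D" and K: "connection_map A D K"
    and G: "\<And>t X Y. t \<in> points (tangent_bundle A) \<Longrightarrow> X \<in> tangent_space (tangent_bundle A) t \<Longrightarrow>
      Y \<in> tangent_space (tangent_bundle A) t \<Longrightarrow> G t X Y = g (fst t) (K t X) (K t Y) +
        g (fst t) (pushforward A fst t X) (pushforward A fst t Y)"
    using assms(2) unfolding sasakian_metric_def by blast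
  interpret manifold_connection A D K
    by unfold_locales (use M D K in \<open>auto simp: smooth_manifold_def levi_civita_connection_def\<close>)
  have P_tensor: "tensor_field_11 A P" and P_inv: "\<And>p v. p \<in> points A \<Longrightarrow> v \<in> tangent_space A p \<Longrightarrow> P p (P p v) = v"
    and P_ne: "\<not> (\<forall>p\<in>points A. \<forall>v\<in>tangent_space A p. P p v = v)"
      "\<not> (\<forall>p\<in>points A. \<forall>v\<in>tangent_space A p. P p v = tv_scale (-1) v)"
    using P unfolding almost_product_structure_def by blast+
  note P_endo = tensor_field_11_endo[OF P_tensor]
  have g02: "tensor_field_02 A g" using g unfolding semi_riemannian_metric_def by blast
  \<comment> \<open>Compatibility is given for vector fields only; every tangent vector extends to one.\<close>
  have gP: "g p (P p u) (P p v) = - 1 * g p u v"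
    if p: "p \<in> points A" and u: "u \<in> tangent_space A p" and v: "v \<in> tangent_space A p" for p u v
  proof -
    obtain X where X: "vector_field A X" "X p = u" using vector_field_extension[OF Hausdorff p u] .
    obtain Y where Y: "vector_field A Y" "Y p = v" using vector_field_extension[OF Hausdorff p v] .
    show ?thesis using gP X Y p unfolding metric_compatible_def by blast
  qed
  \<comment> \<open>The rotation squares to \<open>-1\<close>, the two reflections to \<open>1\<close>, and they anticommute; tensoring the
    reflections with \<open>P\<close> keeps this, because \<open>P\<^sup>2 = Id\<close>, and reverses the sign of the metric.\<close>
  let ?J1 = "split_op (\<lambda>p v. v) 0 (-1) 1 0"
  let ?J2 = "split_op P 1 0 0 (-1)"
  let ?J3 = "split_op P 0 (-1) (-1) 0"
  have PP: "split_op (\<lambda>p v. P p (P p v)) 1 0 0 1 t Y = Y"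
    if "t \<in> points (tangent_bundle A)" "Y \<in> tangent_space (tangent_bundle A) t" for t Y
    using split_op_cong[of t "\<lambda>p v. P p (P p v)" "\<lambda>p v. v" Y 1 0 0 1] split_op_id[OF that, of 1]
      P_inv fst_point that by (simp add: tv_scale_def)
  have J1: "almost_complex_structure (tangent_bundle A) ?J1"
    unfolding almost_complex_structure_def
    using tensor_field_split_op[OF tensor_field_id] split_op_compose[OF tangent_endo_id tangent_endo_id]
      split_op_id[where r = "-1"] by simp
  \<comment> \<open>On the diagonal \<open>m \<otimes> P\<close> acts as \<open>(a + b) P = \<plusminus> P\<close>, so it is \<open>\<plusminus> Id\<close> only if \<open>P\<close> is.\<close>
  have not_scalar: "\<not> (\<forall>t\<in>points (tangent_bundle A). \<forall>Y\<in>tangent_space (tangent_bundle A) t.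
      split_op P a b c d t Y = tv_scale r Y)" if "\<bar>a + b\<bar> = 1" "\<bar>r\<bar> = 1" for a b c d r
  proof
    assume *: "\<forall>t\<in>points (tangent_bundle A). \<forall>Y\<in>tangent_space (tangent_bundle A) t.
      split_op P a b c d t Y = tv_scale r Y"
    have "P p u = tv_scale ((a + b) * r) u" if u: "p \<in> points A" "u \<in> tangent_space A p" for p u
    proof -
      have "tv_scale (a + b) (tv_scale (a + b) (P p u)) = tv_scale (a + b) (tv_scale r u)"
        using split_op_scalar_imp[OF P_endo _ u] * by metis
      moreover have "(a + b) * (a + b) = 1" using \<open>\<bar>a + b\<bar> = 1\<close> by (metis abs_mult_self_eq mult_1)
      ultimately show ?thesis by (simp add: tv_scale_def flip: mult.assoc)
    qed
    moreover have "(a + b) * r = 1 \<or> (a + b) * r = -1" using that by (auto simp: abs_if split: if_splits)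
    ultimately show False using P_ne by (auto simp: tv_scale_def)
  qed
  have product: "almost_product_structure (tangent_bundle A) (split_op P a b c d)"
    if "\<bar>a + b\<bar> = 1" "a * a + b * c = 1" "a * b + b * d = 0" "c * a + d * c = 0" "c * b + d * d = 1" for a b c d
    unfolding almost_product_structure_def
    using tensor_field_split_op[OF P_tensor] split_op_compose[OF P_endo P_endo] PP that(2-)
      not_scalar[OF that(1), of 1] not_scalar[OF that(1), of "-1"] by (simp add: tv_scale_def)
  have J2: "almost_product_structure (tangent_bundle A) ?J2"
    and J3: "almost_product_structure (tangent_bundle A) ?J3"
    by (rule product; simp)+
  have "?J2 t (?J1 t Y) = ?J3 t Y \<and> tv_scale (-1) (?J1 t (?J2 t Y)) = ?J3 t Y"
    if t: "t \<in> points (tangent_bundle A)" "Y \<in> tangent_space (tangent_bundle A) t" for t Y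
    using split_op_compose[OF P_endo tangent_endo_id t] split_op_compose[OF tangent_endo_id P_endo t]
      split_op_minus[OF P_endo t] by simp
  then have "almost_para_hypercomplex (tangent_bundle A) (?J1, ?J2, ?J3)"
    unfolding almost_para_hypercomplex_def using smooth_manifold_tangent_bundle[OF M] J1 J2 J3 by simp
  moreover have "metric_compatible (tangent_bundle A) G 1 ?J1"
    by (rule split_op_metric_compatible[OF tangent_endo_id g02 _ G]) simp_all
  moreover have "metric_compatible (tangent_bundle A) G (-1) ?J2" "metric_compatible (tangent_bundle A) G (-1) ?J3"
    by (rule split_op_metric_compatible[OF P_endo g02 gP G]; simp)+
  ultimately have "almost_para_hypercomplex (tangent_bundle A) (?J1, ?J2, ?J3) \<and>
      para_hyperhermitian (tangent_bundle A) G (?J1, ?J2, ?J3)"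
    unfolding para_hyperhermitian_def by simp
  then show ?thesis by (rule exI)
qed

end
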